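(* Let $F$ be a finite-dimensional real inner product space of dimension at least $1$, with norm $\|\cdot\|_F$, let $T>0$, and let $C\subset F$ be a nonempty closed convex set with $0\in\operatorname{int}C$. Then, for every $N\in\mathbb N$, $$E_N=\frac1{2N},$$ where $E_N$ is the minimax constitutive error defined in the context. Moreover, the value is attained by the stress-aware encoder $$h_N^\star(\pi):=S_N^\star(\mathcal P(\pi)),\qquad \pi\in W^{1,1}([0,T];F),$$ and $$\|\mathcal P(\pi)-g_N^\star(h_N^\star(\pi))\|_{L^\infty([0,T];F)}\le\frac1{2N}\|\pi\|_{BV,0}\qquad\text{for all }\pi\in W^{1,1}([0,T];F).$$ Here $\mathcal P$ is the elastic-plastic history operator of $C$, $g_N^\star$ the discrete hereditary decoder, and $S_N^\star$ sampled equal-variation approximation, all defined in the context.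
   Context: Variation and norms: for $u:[0,T]\to F$ and $[a,b]\subset[0,T]$, $\operatorname{Var}(u;[a,b])=\sup\sum_j\|u(t_j)-u(t_{j-1})\|_F$ over all partitions of $[a,b]$; $\|u\|_{BV,0}:=\|u(0)\|_F+\operatorname{Var}(u;[0,T])$. Elements of $W^{1,1}([0,T];F)$ are identified with their absolutely continuous representatives; $W^{1,1}([0,T];C)$ is the subset of those with values in $C$. Projection and normal cone: $P_C$ is the metric projection onto $C$ in $\|\cdot\|_F$; $N_C(\sigma)=\{\nu\in F:\langle\nu,z-\sigma\rangle_F\le0\ \forall z\in C\}$ for $\sigma\in C$. History operator: it is a known result (standard sweeping-process theory) that for every $\pi\in W^{1,1}([0,T];F)$ there is a unique $\sigma\in W^{1,1}([0,T];C)$ with $\sigma(0)=P_C(\pi(0))$, $\sigma(t)\in C$ for all $t\in[0,T]$, and $\dot\pi(t)-\dot\sigma(t)\in N_C(\sigma(t))$ for a.e. $t\in(0,T)$. Set $\mathcal P(\pi):=\sigma$. Step functions: $\mathcal Z_N$ is the set of functions $z:[0,T]\to F$ for which there exist $M\le N$, a partition $0=t_0<\dots<t_M=T$ and values $z_0,\dots,z_M\in F$ with $z(t)=z_{k-1}$ for $t\in[t_{k-1},t_k)$, $k=1,\dots,M$, and $z(T)=z_M$. Decoder: let $z\in\mathcal Z_N$ be represented by a partition $0=t_0<\dots<t_M=T$ with $M\le N$ and values $z_0,\dots,z_M\in F$, so that $z(t)=z_{k-1}$ for $t\in[t_{k-1},t_k)$, $k=1,\dots,M$, and $z(T)=z_M$.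 Then $g_N^\star(z)$ is the step function with value $\sigma_{k-1}$ on $[t_{k-1},t_k)$, $k=1,\dots,M$, and $\sigma_M$ at $T$, where $\sigma_0:=P_C(z_0)$ and $\sigma_k:=P_C(\sigma_{k-1}+z_k-z_{k-1})$ for $k=1,\dots,M$ (this does not depend on the partition used to represent $z$). Errors: an encoder is an arbitrary map $f_N:W^{1,1}([0,T];F)\to\mathcal Z_N$; $$E(f_N):=\sup_{\pi\in W^{1,1}([0,T];F)\setminus\{0\}}\frac{\|\mathcal P(\pi)-g_N^\star(f_N(\pi))\|_{L^\infty([0,T];F)}}{\|\pi\|_{BV,0}},\qquad E_N:=\inf_{f_N}E(f_N),$$ the infimum being over all encoders. "Attained by $h_N^\star$" means $E(h_N^\star)=E_N$. Sampled equal-variation approximation: for $\sigma\in W^{1,1}([0,T];C)$ let $V:=\operatorname{Var}(\sigma;[0,T])$ and $\alpha(t):=\operatorname{Var}(\sigma;[0,t])$. If $V=0$, $S_N^\star(\sigma)\equiv\sigma(0)$. If $V>0$, let $t_k:=\min\{t\in[0,T]:\alpha(t)=kV/N\}$ for $k=0,\dots,N-1$, $t_N:=T$, choose $\tau_k\in[t_{k-1},t_k]$ with $\alpha(\tau_k)=\frac{(2k-1)V}{2N}$, $k=1,\dots,N$ (any such choice), and set $S_N^\star(\sigma)(t):=\sigma(\tau_k)$ for $t\in[t_{k-1},t_k)$ and $S_N^\star(\sigma)(T):=\sigma(T)$. *)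

theory Defs
  imports "HOL-Analysis.Analysis" "HOL-Probability.Essential_Supremum"
begin

text \<open>
  A function on \<open>[0,T]\<close> is a total function that is \<open>undefined\<close> outside \<open>{0..T}\<close>
  (\<open>extensional {0..T}\<close>), so that functions on \<open>[0,T]\<close> correspond one-to-one to such objects; in
  particular, an encoder sees only the values on \<open>[0,T]\<close>, and the solution of the sweeping process
  is literally unique.
\<close>

subsection \<open>Partitions, variation and the space \<open>W\<^sup>1\<^sup>,\<^sup>1\<close>\<close>

definition is_partition :: "real \<Rightarrow> real \<Rightarrow> nat \<Rightarrow> (nat \<Rightarrow> real) \<Rightarrow> bool" where
  "is_partition a b n t \<longleftrightarrow> t 0 = a \<and> t n = b \<and> (\<forall>j<n. t j < t (Suc j))"

text \<open>
  The supremum is the real one, hence meaningful only for functions of bounded variation; it is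
  applied only to elements of \<open>W\<^sup>1\<^sup>,\<^sup>1\<close>. For \<open>a = b\<close> the only partition has \<open>n = 0\<close>, and the
  variation is \<open>0\<close>.
\<close>
definition variation :: "(real \<Rightarrow> 'a::real_normed_vector) \<Rightarrow> real \<Rightarrow> real \<Rightarrow> real" where
  "variation u a b =
     Sup {\<Sum>j<n. norm (u (t (Suc j)) - u (t j)) | n t. is_partition a b n t}"

definition norm_BV0 :: "real \<Rightarrow> (real \<Rightarrow> 'a::real_normed_vector) \<Rightarrow> real" where
  "norm_BV0 T u = norm (u 0) + variation u 0 T"

text \<open>
  Elements of \<open>W\<^sup>1\<^sup>,\<^sup>1([0,T];F)\<close> are given by their absolutely continuous representatives, the
  primitives \<open>u(t) = u(0) + \<integral>\<^sub>0\<^sup>t g\<close> of integrable functions \<open>g\<close>; then \<open>g\<close> is the weak (and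
  almost everywhere classical) derivative of \<open>u\<close>, and it is unique up to null sets.
\<close>
definition has_L1_derivative ::
    "real \<Rightarrow> (real \<Rightarrow> 'a::euclidean_space) \<Rightarrow> (real \<Rightarrow> 'a) \<Rightarrow> bool" where
  "has_L1_derivative T u g \<longleftrightarrow>
     g absolutely_integrable_on {0..T} \<and> (\<forall>t\<in>{0..T}. u t = u 0 + integral {0..t} g)"

definition W11 :: "real \<Rightarrow> (real \<Rightarrow> 'a::euclidean_space) set" where
  "W11 T = {u \<in> extensional {0..T}. \<exists>g. has_L1_derivative T u g}"

definition W11_in :: "real \<Rightarrow> 'a::euclidean_space set \<Rightarrow> (real \<Rightarrow> 'a) set" where
  "W11_in T C = {u \<in> W11 T. \<forall>t\<in>{0..T}. u t \<in> C}"

definition zero_fun :: "real \<Rightarrow> real \<Rightarrow> 'a::euclidean_space" where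
  "zero_fun T = restrict (\<lambda>t. 0) {0..T}"


subsection \<open>The history operator\<close>

definition normal_cone :: "'a::real_inner set \<Rightarrow> 'a \<Rightarrow> 'a set" where
  "normal_cone C x = {\<nu>. \<forall>z\<in>C. inner \<nu> (z - x) \<le> 0}"

text \<open>
  The derivatives \<open>p\<close> of \<open>\<pi>\<close> and \<open>s\<close> of \<open>\<sigma>\<close> are unique up to null sets, so the existential
  quantifier could equally be universal. The library's \<open>closest_point C\<close> is the metric projection
  onto \<open>C\<close>.
\<close>
definition sweeping_solution ::
    "real \<Rightarrow> 'a::euclidean_space set \<Rightarrow> (real \<Rightarrow> 'a) \<Rightarrow> (real \<Rightarrow> 'a) \<Rightarrow> bool" where
  "sweeping_solution T C \<pi> \<sigma> \<longleftrightarrow>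
     \<sigma> \<in> W11_in T C \<and> \<sigma> 0 = closest_point C (\<pi> 0) \<and>
     (\<exists>p s. has_L1_derivative T \<pi> p \<and> has_L1_derivative T \<sigma> s \<and>
        (AE t in lebesgue_on {0<..<T}. p t - s t \<in> normal_cone C (\<sigma> t)))"

definition history_op ::
    "real \<Rightarrow> 'a::euclidean_space set \<Rightarrow> (real \<Rightarrow> 'a) \<Rightarrow> real \<Rightarrow> 'a" where
  "history_op T C \<pi> = (THE \<sigma>. sweeping_solution T C \<pi> \<sigma>)"


subsection \<open>Step functions and the decoder\<close>

text \<open>Value \<open>v k\<close> on \<open>[t\<^sub>k, t\<^sub>k\<^sub>+\<^sub>1)\<close> for \<open>k < M\<close>, and \<open>v M\<close> at \<open>T\<close>.\<close>
definition step_fun ::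
    "real \<Rightarrow> nat \<Rightarrow> (nat \<Rightarrow> real) \<Rightarrow> (nat \<Rightarrow> 'a) \<Rightarrow> real \<Rightarrow> 'a" where
  "step_fun T M t v =
     restrict (\<lambda>s. if s = T then v M else v (THE k. k < M \<and> t k \<le> s \<and> s < t (Suc k))) {0..T}"

definition represents ::
    "real \<Rightarrow> nat \<Rightarrow> (real \<Rightarrow> 'a) \<Rightarrow> nat \<Rightarrow> (nat \<Rightarrow> real) \<Rightarrow> (nat \<Rightarrow> 'a) \<Rightarrow> bool" where
  "represents T N z M t v \<longleftrightarrow> M \<le> N \<and> is_partition 0 T M t \<and> z = step_fun T M t v"

definition step_functions :: "real \<Rightarrow> nat \<Rightarrow> (real \<Rightarrow> 'a) set" where
  "step_functions T N = {z. \<exists>M t v. represents T N z M t v}"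

primrec decoder_values ::
    "'a::euclidean_space set \<Rightarrow> (nat \<Rightarrow> 'a) \<Rightarrow> nat \<Rightarrow> 'a" where
  "decoder_values C v 0 = closest_point C (v 0)"
| "decoder_values C v (Suc k) = closest_point C (decoder_values C v k + v (Suc k) - v k)"

text \<open>The result does not depend on the representation of \<open>z\<close> that is chosen.\<close>
definition decoder ::
    "real \<Rightarrow> 'a::euclidean_space set \<Rightarrow> nat \<Rightarrow> (real \<Rightarrow> 'a) \<Rightarrow> real \<Rightarrow> 'a" where
  "decoder T C N z =
     (let (M, t, v) = (SOME (M, t, v). represents T N z M t v)
      in step_fun T M t (decoder_values C v))"


subsection \<open>Errors\<close>

definition encoders :: "real \<Rightarrow> nat \<Rightarrow> ((real \<Rightarrow> 'a::euclidean_space) \<Rightarrow> real \<Rightarrow> 'a) set" where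
  "encoders T N = W11 T \<rightarrow> step_functions T N"

definition norm_Linf :: "real \<Rightarrow> (real \<Rightarrow> 'a::real_normed_vector) \<Rightarrow> ereal" where
  "norm_Linf T u = esssup (lebesgue_on {0..T}) (\<lambda>t. ereal (norm (u t)))"

definition recon_error ::
    "real \<Rightarrow> 'a::euclidean_space set \<Rightarrow> nat \<Rightarrow> ((real \<Rightarrow> 'a) \<Rightarrow> real \<Rightarrow> 'a) \<Rightarrow> (real \<Rightarrow> 'a) \<Rightarrow> ereal" where
  "recon_error T C N f \<pi> = norm_Linf T (\<lambda>t. history_op T C \<pi> t - decoder T C N (f \<pi>) t)"

definition worst_error ::
    "real \<Rightarrow> 'a::euclidean_space set \<Rightarrow> nat \<Rightarrow> ((real \<Rightarrow> 'a) \<Rightarrow> real \<Rightarrow> 'a) \<Rightarrow> ereal" where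
  "worst_error T C N f =
     (SUP \<pi> \<in> W11 T - {zero_fun T}. recon_error T C N f \<pi> / ereal (norm_BV0 T \<pi>))"

definition minimax_error :: "real \<Rightarrow> 'a::euclidean_space set \<Rightarrow> nat \<Rightarrow> ereal" where
  "minimax_error T C N = (INF f \<in> encoders T N. worst_error T C N f)"


subsection \<open>Sampled equal-variation approximation and the stress-aware encoder\<close>

definition level_time :: "real \<Rightarrow> nat \<Rightarrow> (real \<Rightarrow> 'a::euclidean_space) \<Rightarrow> nat \<Rightarrow> real" where
  "level_time T N \<sigma> k =
     (if k < N
      then (LEAST t. t \<in> {0..T} \<and> variation \<sigma> 0 t = real k * variation \<sigma> 0 T / real N)
      else T)"

definition admissible_times ::
    "real \<Rightarrow> nat \<Rightarrow> (real \<Rightarrow> 'a::euclidean_space) \<Rightarrow> (nat \<Rightarrow> real) \<Rightarrow> bool" where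
  "admissible_times T N \<sigma> \<tau> \<longleftrightarrow>
     (\<forall>k\<in>{1..N}. \<tau> k \<in> {level_time T N \<sigma> (k - 1)..level_time T N \<sigma> k} \<and>
        variation \<sigma> 0 (\<tau> k) = (2 * real k - 1) * variation \<sigma> 0 T / (2 * real N))"

text \<open>The sampling times \<open>\<tau>\<close> matter only if \<open>\<sigma>\<close> has positive variation.\<close>
definition sampled_approx ::
    "real \<Rightarrow> nat \<Rightarrow> (nat \<Rightarrow> real) \<Rightarrow> (real \<Rightarrow> 'a::euclidean_space) \<Rightarrow> real \<Rightarrow> 'a" where
  "sampled_approx T N \<tau> \<sigma> =
     (if variation \<sigma> 0 T = 0 then restrict (\<lambda>t. \<sigma> 0) {0..T}
      else step_fun T N (level_time T N \<sigma>) (\<lambda>k. if k < N then \<sigma> (\<tau> (Suc k)) else \<sigma> T))"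

definition sampling_rule ::
    "real \<Rightarrow> 'a::euclidean_space set \<Rightarrow> nat \<Rightarrow> ((real \<Rightarrow> 'a) \<Rightarrow> nat \<Rightarrow> real) \<Rightarrow> bool" where
  "sampling_rule T C N \<tau> \<longleftrightarrow>
     (\<forall>\<sigma>\<in>W11_in T C. variation \<sigma> 0 T > 0 \<longrightarrow> admissible_times T N \<sigma> (\<tau> \<sigma>))"

definition stress_encoder ::
    "real \<Rightarrow> 'a::euclidean_space set \<Rightarrow> nat \<Rightarrow> ((real \<Rightarrow> 'a) \<Rightarrow> nat \<Rightarrow> real) \<Rightarrow>
     (real \<Rightarrow> 'a) \<Rightarrow> real \<Rightarrow> 'a" where
  "stress_encoder T C N \<tau> \<pi> =
     sampled_approx T N (\<tau> (history_op T C \<pi>)) (history_op T C \<pi>)"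

end

(*
  Upper bound: the stress is tracked in its own variation, so it moves by at most V/(2N) away from
  the sample on each of the N pieces. The samples lie in C, so the decoder leaves them unchanged,
  and V does not exceed the variation of the input because the projection is nonexpansive.
  Lower bound: a uniform straight path in C is its own stress, and some piece of any step function
  with at most N pieces covers a portion of it of relative length at least 1/N.

  Solutions of the sweeping process are obtained by compactness from catching-up schemes on finite
  sets of times. The bounds that survive involve two times only and have a quadratic error in the
  variation G of the input:
    (xi(b) - xi(a)) . (z - sigma(a)) <= 2 (G(b) - G(a))^2   with xi = pi - sigma, z in C.
  An additive interval function with such a quadratic bound is nonpositive. This turns the bound
  into the differential inclusion, and gives uniqueness when applied to |sigma_2 - sigma_1|^2.
*)
theory Submission
  imports Defs "HOL-Probability.Distribution_Functions"
begin

subsection \<open>Variation\<close>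

text \<open>Compactness preserves closed conditions on finitely many times, so the limit of the
  schemes arrives without a derivative. For this reason everything is expressed by increments. The
  bound \<open>G(b) - G(a)\<close> on the increments of the stress survives too; it is dominated by
  a primitive of the norm of the input's derivative, and the Radon-Nikodym theorem turns that into
  an integrable derivative of the stress. Origin of the constant 2: for a true solution
  \<open>xi' . (z - sigma(r)) <= 0\<close>. Replacing \<open>sigma(r)\<close> by
  \<open>sigma(a)\<close> costs at most the variation of \<open>xi\<close> times that of
  \<open>sigma\<close>. Since \<open>G\<close> controls both \<open>pi\<close> and
  \<open>sigma\<close>, the first factor is at most \<open>2 (G(b) - G(a))\<close> and the second at
  most \<open>G(b) - G(a)\<close>. Factor 1/2 in the lower bound: a single value has to serve both
  ends of a piece, and it misses one of them by at least half their distance. This concerns every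
  step function with at most N pieces, hence the decoder's output for any encoder.\<close>

text \<open>\<open>\<beta>\<close> is a majorant of the variation. It provides the bound under which
  the real \<open>Sup\<close> in \<open>variation\<close> is meaningful. Allowing a general set
  \<open>S\<close> makes the notion available for functions known only at finitely many
  times.\<close>

definition controlled_by :: "real set \<Rightarrow> (real \<Rightarrow> 'a::real_normed_vector) \<Rightarrow> (real \<Rightarrow> real) \<Rightarrow> bool" where
  "controlled_by S u \<beta> \<longleftrightarrow> (\<forall>x\<in>S. \<forall>y\<in>S. x \<le> y \<longrightarrow> norm (u y - u x) \<le> \<beta> y - \<beta> x)"

lemma controlled_byD:
  "controlled_by S u \<beta> \<Longrightarrow> x \<in> S \<Longrightarrow> y \<in> S \<Longrightarrow> x \<le> y \<Longrightarrow> norm (u y - u x) \<le> \<beta> y - \<beta> x"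
  unfolding controlled_by_def by blast

lemma controlled_by_mono:
  "controlled_by S u \<beta> \<Longrightarrow> x \<in> S \<Longrightarrow> y \<in> S \<Longrightarrow> x \<le> y \<Longrightarrow> \<beta> x \<le> \<beta> y"
  using controlled_byD[of S u \<beta> x y] norm_ge_zero[of "u y - u x"] by linarith

lemma controlled_by_subset: "controlled_by S u \<beta> \<Longrightarrow> R \<subseteq> S \<Longrightarrow> controlled_by R u \<beta>"
  unfolding controlled_by_def by blast

lemma is_partition_mono:
  assumes "is_partition a b n t" "i \<le> j" "j \<le> n"
  shows "t i \<le> t j"
  using assms(2,3)
proof (induction j rule: dec_induct)
  case (step j)
  then have "t j < t (Suc j)" using assms(1) unfolding is_partition_def by auto
  with step show ?case by auto
qed simp

lemma is_partition_strict_mono: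
  assumes "is_partition a b n t" "i < j" "j \<le> n"
  shows "t i < t j"
proof -
  have "t i < t (Suc i)" using assms unfolding is_partition_def by auto
  also have "\<dots> \<le> t j" using is_partition_mono[OF assms(1), of "Suc i" j] assms by auto
  finally show ?thesis .
qed

lemma is_partition_range:
  assumes "is_partition a b n t" "j \<le> n"
  shows "t j \<in> {a..b}"
  using is_partition_mono[OF assms(1), of 0 j] is_partition_mono[OF assms(1), of j n] assms
  unfolding is_partition_def by auto

lemma is_partition_exists:
  assumes "a \<le> b" shows "\<exists>n t. is_partition a b n t"
proof (cases "a = b")
  case True
  then show ?thesis by (intro exI[of _ 0] exI[of _ "\<lambda>_. a"]) (simp add: is_partition_def)
next
  case False
  then show ?thesis using assms
    by (intro exI[of _ 1] exI[of _ "\<lambda>j. if j = 0 then a else b"]) (simp add: is_partition_def)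
qed

lemma partition_sum_le:
  assumes "controlled_by {a..b} u \<beta>" "is_partition a b n t"
  shows "(\<Sum>j<n. norm (u (t (Suc j)) - u (t j))) \<le> \<beta> b - \<beta> a"
proof -
  have "(\<Sum>j<n. norm (u (t (Suc j)) - u (t j))) \<le> (\<Sum>j<n. \<beta> (t (Suc j)) - \<beta> (t j))"
  proof (rule sum_mono)
    fix j assume "j \<in> {..<n}"
    then show "norm (u (t (Suc j)) - u (t j)) \<le> \<beta> (t (Suc j)) - \<beta> (t j)"
      using is_partition_range[OF assms(2), of j] is_partition_range[OF assms(2), of "Suc j"]
        is_partition_mono[OF assms(2), of j "Suc j"]
      by (intro controlled_byD[OF assms(1)]) auto
  qed
  also have "\<dots> = \<beta> (t n) - \<beta> (t 0)" by (rule sum_lessThan_telescope)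
  finally show ?thesis using assms(2) unfolding is_partition_def by simp
qed

lemma variation_le:
  assumes "a \<le> b" "controlled_by {a..b} u \<beta>"
  shows "variation u a b \<le> \<beta> b - \<beta> a"
  unfolding variation_def
proof (rule cSup_least)
  show "{\<Sum>j<n. norm (u (t (Suc j)) - u (t j)) |n t. is_partition a b n t} \<noteq> {}"
    using is_partition_exists[OF assms(1)] by blast
qed (use partition_sum_le[OF assms(2)] in blast)

lemma variation_ge:
  assumes "controlled_by {a..b} u \<beta>" "is_partition a b n t"
  shows "(\<Sum>j<n. norm (u (t (Suc j)) - u (t j))) \<le> variation u a b"
  unfolding variation_def
proof (rule cSup_upper)
  show "bdd_above {\<Sum>j<n. norm (u (t (Suc j)) - u (t j)) |n t. is_partition a b n t}"
    using partition_sum_le[OF assms(1)] unfolding bdd_above_def by blast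
qed (use assms(2) in blast)

lemma variation_self [simp]: "variation u a a = 0"
proof -
  have "n = 0" if "is_partition a a n t" for n t
    using is_partition_strict_mono[OF that, of 0 n] that unfolding is_partition_def by auto
  then have "{\<Sum>j<n. norm (u (t (Suc j)) - u (t j)) |n t. is_partition a a n t} = {0}"
    using is_partition_exists[of a a] by fastforce
  then show ?thesis unfolding variation_def by simp
qed

text \<open>Appending the point \<open>y\<close> to a partition of \<open>{a..x}\<close> adds the
  term \<open>norm (u y - u x)\<close> to its sum. The control \<open>\<beta>\<close> guarantees
  that the suprema involved are those of bounded sets.\<close>

lemma controlled_by_variation:
  assumes "controlled_by {a..b} u \<beta>"
  shows "controlled_by {a..b} u (variation u a)"
  unfolding controlled_by_def
proof (intro ballI impI)
  fix x y assume xy: "x \<in> {a..b}" "y \<in> {a..b}" "x \<le> y"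
  show "norm (u y - u x) \<le> variation u a y - variation u a x"
  proof (cases "x = y")
    case False
    have "variation u a x \<le> variation u a y - norm (u y - u x)"
      unfolding variation_def[of u a x]
    proof (rule cSup_least)
      show "{\<Sum>j<n. norm (u (t (Suc j)) - u (t j)) |n t. is_partition a x n t} \<noteq> {}"
        using is_partition_exists[of a x] xy by auto
    next
      fix r assume "r \<in> {\<Sum>j<n. norm (u (t (Suc j)) - u (t j)) |n t. is_partition a x n t}"
      then obtain n t where r: "r = (\<Sum>j<n. norm (u (t (Suc j)) - u (t j)))"
        and t: "is_partition a x n t" by blast
      define t' where "t' = t(Suc n := y)"
      have "is_partition a y (Suc n) t'"
        using t xy False unfolding is_partition_def t'_def by (auto simp: less_Suc_eq)
      then have "(\<Sum>j<Suc n. norm (u (t' (Suc j)) - u (t' j))) \<le> variation u a y"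
        using xy by (intro variation_ge[OF controlled_by_subset[OF assms, of "{a..y}"]]) auto
      moreover have "(\<Sum>j<n. norm (u (t' (Suc j)) - u (t' j))) = r"
        unfolding r t'_def by (intro sum.cong) auto
      moreover have "t' (Suc n) = y" "t' n = x"
        using t unfolding t'_def is_partition_def by auto
      ultimately show "r \<le> variation u a y - norm (u y - u x)" by simp
    qed
    then show ?thesis by simp
  qed simp
qed

text \<open>The variation is the least control: every other one grows at least as fast on every
  subinterval. With the integral of the norm of a derivative as \<open>\<beta>\<close>, continuity
  of the variation follows.\<close>

lemma variation_diff_le:
  assumes "controlled_by {a..b} u \<beta>" "x \<in> {a..b}" "y \<in> {a..b}" "x \<le> y"
  shows "variation u a y - variation u a x \<le> \<beta> y - \<beta> x"
proof -
  \<comment> \<open>Gluing the variation up to \<open>x\<close> to \<open>\<beta>\<close> beyond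
    \<open>x\<close> yields a control on \<open>{a..y}\<close>, so no partition has to be split at
    \<open>x\<close>.\<close>
  define \<gamma> where "\<gamma> t = (if t \<le> x then variation u a t else variation u a x + (\<beta> t - \<beta> x))" for t
  have "controlled_by {a..y} u \<gamma>"
    unfolding controlled_by_def
  proof (intro ballI impI)
    fix r s assume rs: "r \<in> {a..y}" "s \<in> {a..y}" "r \<le> s"
    consider "s \<le> x" | "r \<le> x" "x < s" | "x < r" by linarith
    then show "norm (u s - u r) \<le> \<gamma> s - \<gamma> r"
    proof cases
      case 1
      then show ?thesis using rs assms controlled_byD[OF controlled_by_variation[OF assms(1)], of r s]
        by (simp add: \<gamma>_def)
    next
      case 2
      have "norm (u s - u r) \<le> norm (u s - u x) + norm (u x - u r)"
        using norm_triangle_ineq[of "u s - u x" "u x - u r"] by simp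
      with 2 show ?thesis
        using rs assms controlled_byD[OF controlled_by_variation[OF assms(1)], of r x]
          controlled_byD[OF assms(1), of x s]
        by (simp add: \<gamma>_def)
    next
      case 3
      then show ?thesis using rs assms controlled_byD[OF assms(1), of r s] by (simp add: \<gamma>_def)
    qed
  qed
  then have "variation u a y \<le> \<gamma> y - \<gamma> a"
    using assms by (intro variation_le) auto
  moreover have "\<gamma> a = 0" using assms by (simp add: \<gamma>_def)
  moreover have "\<gamma> y = variation u a x + (\<beta> y - \<beta> x)" using assms by (auto simp: \<gamma>_def)
  ultimately show ?thesis by simp
qed

section \<open>Primitives of integrable functions\<close>

lemma L1_derivative_diff:
  assumes "has_L1_derivative T u g" "0 \<le> a" "a \<le> b" "b \<le> T"
  shows "u b - u a = integral {a..b} g"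
proof -
  have "g integrable_on {0..b}"
    using assms unfolding has_L1_derivative_def
    by (intro integrable_on_subinterval[of g "{0..T}" 0 b]) (auto simp: absolutely_integrable_on_def)
  then have "integral {0..a} g + integral {a..b} g = integral {0..b} g"
    using assms by (intro Henstock_Kurzweil_Integration.integral_combine) auto
  moreover have "u t - u 0 = integral {0..t} g" if "t \<in> {0..T}" for t
    using assms(1) that unfolding has_L1_derivative_def by (metis add_diff_cancel_left')
  from this[of a] this[of b] have "u a - u 0 = integral {0..a} g" "u b - u 0 = integral {0..b} g"
    using assms by auto
  ultimately show ?thesis by (metis add_diff_cancel_left' diff_diff_eq2 diff_add_cancel)
qed

lemma abs_integrable_subinterval:
  fixes g :: "real \<Rightarrow> 'a::euclidean_space"
  assumes "g absolutely_integrable_on {0..T}" "0 \<le> a" "b \<le> T"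
  shows "g absolutely_integrable_on {a..b}"
  using assms by (intro set_integrable_subset[OF assms(1)]) auto

lemma L1_derivativeI:
  assumes "g absolutely_integrable_on {0..T}"
    and "\<And>t. 0 \<le> t \<Longrightarrow> t \<le> T \<Longrightarrow> u t - u 0 = integral {0..t} g"
  shows "has_L1_derivative T u g"
  unfolding has_L1_derivative_def
proof (intro conjI ballI)
  fix t assume "t \<in> {0..T}"
  then show "u t = u 0 + integral {0..t} g"
    using assms(2)[of t] by (metis atLeastAtMost_iff diff_add_cancel add.commute)
qed (fact assms(1))

lemma integral_Icc_diff:
  fixes g :: "real \<Rightarrow> 'a::euclidean_space"
  assumes "g absolutely_integrable_on {0..T}" "0 \<le> a" "a \<le> b" "b \<le> T"
  shows "integral {0..b} g - integral {0..a} g = integral {a..b} g"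
  using L1_derivative_diff[of T "\<lambda>t. integral {0..t} g" g a b] assms
  by (simp add: has_L1_derivative_def)

lemma controlled_by_integral_norm:
  assumes "has_L1_derivative T u g"
  shows "controlled_by {0..T} u (\<lambda>t. integral {0..t} (\<lambda>s. norm (g s)))"
  unfolding controlled_by_def
proof (intro ballI impI)
  fix x y assume xy: "x \<in> {0..T}" "y \<in> {0..T}" "x \<le> y"
  have g: "g absolutely_integrable_on {0..T}" using assms by (simp add: has_L1_derivative_def)
  then have g': "(\<lambda>s. norm (g s)) absolutely_integrable_on {0..T}"
    by (rule absolutely_integrable_norm[unfolded o_def])
  have "norm (integral {x..y} g) \<le> integral {x..y} (\<lambda>s. norm (g s))"
    using abs_integrable_subinterval[OF g, of x y] xy
    by (intro integral_norm_bound_integral) (auto simp: absolutely_integrable_on_def)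
  then show "norm (u y - u x) \<le> integral {0..y} (\<lambda>s. norm (g s)) - integral {0..x} (\<lambda>s. norm (g s))"
    using L1_derivative_diff[OF assms, of x y] integral_Icc_diff[OF g', of x y] xy by simp
qed

lemma continuous_on_indefinite_integral:
  fixes g :: "real \<Rightarrow> 'a::euclidean_space"
  assumes "g absolutely_integrable_on {0..T}"
  shows "continuous_on {0..T} (\<lambda>t. integral {0..t} g)"
  using assms by (intro indefinite_integral_continuous_1) (simp add: absolutely_integrable_on_def)

lemma controlled_by_continuous_on:
  assumes "controlled_by {a..b} u \<beta>" "continuous_on {a..b} \<beta>"
  shows "continuous_on {a..b} u"
  unfolding continuous_on_iff
proof (intro ballI allI impI)
  fix x e :: real assume x: "x \<in> {a..b}" and e: "e > 0"
  from assms(2) x e obtain d where d: "d > 0" "\<And>y. y \<in> {a..b} \<Longrightarrow> dist y x < d \<Longrightarrow> dist (\<beta> y) (\<beta> x) < e"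
    unfolding continuous_on_iff by meson
  have "dist (u y) (u x) < e" if y: "y \<in> {a..b}" "dist y x < d" for y
  proof -
    have "norm (u y - u x) \<le> \<bar>\<beta> y - \<beta> x\<bar>"
      using controlled_byD[OF assms(1), of x y] controlled_byD[OF assms(1), of y x] x y
      by (cases "x \<le> y") (auto simp: norm_minus_commute)
    with d(2)[OF y] show ?thesis by (simp add: dist_norm)
  qed
  with d(1) show "\<exists>d>0. \<forall>y\<in>{a..b}. dist y x < d \<longrightarrow> dist (u y) (u x) < e" by blast
qed

lemma W11_derivativeE:
  assumes "u \<in> W11 T"
  obtains g where "has_L1_derivative T u g"
  using assms unfolding W11_def by blast

lemma W11_controlled_by_variation:
  "u \<in> W11 T \<Longrightarrow> controlled_by {0..T} u (variation u 0)"
  by (meson W11_derivativeE controlled_by_integral_norm controlled_by_variation)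

lemma variation_continuous_on:
  assumes "u \<in> W11 T"
  shows "continuous_on {0..T} (variation u 0)"
proof -
  obtain g where g: "has_L1_derivative T u g" using assms by (rule W11_derivativeE)
  let ?\<beta> = "\<lambda>t. integral {0..t} (\<lambda>s. norm (g s))"
  have "continuous_on {0..T} ?\<beta>"
    using g by (intro continuous_on_indefinite_integral absolutely_integrable_norm[unfolded o_def])
      (simp add: has_L1_derivative_def)
  moreover have "controlled_by {0..T} (variation u 0) ?\<beta>"
    using controlled_by_integral_norm[OF g] variation_diff_le[OF controlled_by_integral_norm[OF g]]
      controlled_by_mono[OF W11_controlled_by_variation[OF assms]]
    unfolding controlled_by_def by (fastforce simp: abs_le_iff)
  ultimately show ?thesis by (rule controlled_by_continuous_on[rotated])
qed

text \<open>Bisecting along the values of \<open>G\<close> halves the total bound at every step.\<close>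
lemma nonincreasing_if_quadratic_bound:
  fixes H G :: "real \<Rightarrow> real"
  assumes G: "continuous_on {a..b} G"
    and H: "\<And>x y. a \<le> x \<Longrightarrow> x \<le> y \<Longrightarrow> y \<le> b \<Longrightarrow> G x \<le> G y \<and> H y - H x \<le> K * (G y - G x)\<^sup>2"
    and "a \<le> b"
  shows "H b \<le> H a"
proof -
  have *: "H y - H x \<le> K * (G y - G x)\<^sup>2 / 2 ^ n" if "a \<le> x" "x \<le> y" "y \<le> b" for x y n
    using that
  proof (induction n arbitrary: x y)
    case (Suc n)
    have "continuous_on {x..y} G" using G Suc.prems by (auto intro: continuous_on_subset)
    moreover have "G x \<le> (G x + G y) / 2" "(G x + G y) / 2 \<le> G y"
      using H[OF Suc.prems] by auto
    ultimately obtain c where c: "x \<le> c" "c \<le> y" "G c = (G x + G y) / 2"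
      using IVT'[of G x "(G x + G y) / 2" y] Suc.prems by blast
    have "H c - H x \<le> K * (G c - G x)\<^sup>2 / 2 ^ n" "H y - H c \<le> K * (G y - G c)\<^sup>2 / 2 ^ n"
      using Suc.prems c by (auto intro!: Suc.IH)
    moreover have "G c - G x = (G y - G x) / 2" "G y - G c = (G y - G x) / 2"
      using c by (auto simp: field_simps)
    ultimately have "H y - H x \<le> K * ((G y - G x) / 2)\<^sup>2 / 2 ^ n + K * ((G y - G x) / 2)\<^sup>2 / 2 ^ n"
      by simp
    also have "\<dots> = K * (G y - G x)\<^sup>2 / 2 ^ Suc n"
      by (simp add: power_divide field_simps)
    finally show ?case .
  qed (use H in auto)
  have "(\<lambda>n. K * (G b - G a)\<^sup>2 * (1 / 2) ^ n) \<longlonglongrightarrow> K * (G b - G a)\<^sup>2 * 0"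
    by (intro tendsto_intros LIMSEQ_power_zero) simp
  then have "H b - H a \<le> K * (G b - G a)\<^sup>2 * 0"
    by (rule LIMSEQ_le_const) (use *[of a b] assms in \<open>auto simp: power_divide\<close>)
  then show ?thesis by simp
qed

subsection \<open>Absolutely continuous functions have an integrable derivative\<close>

text \<open>The difference of the distribution functions is the distribution function of a measure \<open>D\<close>
  with \<open>N = M + D\<close>.\<close>
lemma emeasure_le_if_Ioc_le:
  fixes M N :: "real measure"
  assumes "finite_measure M" "finite_measure N" "sets M = sets borel" "sets N = sets borel"
    and le: "\<And>a b. a \<le> b \<Longrightarrow> emeasure M {a<..b} \<le> emeasure N {a<..b}"
    and E: "E \<in> sets borel"
  shows "emeasure M E \<le> emeasure N E"
proof -
  interpret M: finite_borel_measure M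
    using assms(1,3) by (simp add: finite_borel_measure_def finite_borel_measure_axioms_def)
  interpret N: finite_borel_measure N
    using assms(2,4) by (simp add: finite_borel_measure_def finite_borel_measure_axioms_def)
  define F where "F t = cdf N t - cdf M t" for t
  have F_diff: "F y - F x = measure N {x<..y} - measure M {x<..y}" if "x \<le> y" for x y
  proof (cases "x = y")
    case False
    then show ?thesis using M.cdf_diff_eq[of x y] N.cdf_diff_eq[of x y] that by (simp add: F_def)
  qed simp
  have measure_le: "measure M {x<..y} \<le> measure N {x<..y}" if "x \<le> y" for x y
    using le[OF that] by (simp add: M.emeasure_eq_measure N.emeasure_eq_measure)
  have F_mono: "F x \<le> F y" if "x \<le> y" for x y
    using F_diff[OF that] measure_le[OF that] by simp
  have F_rc: "continuous (at_right a) F" for a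
    unfolding F_def[abs_def]
    by (intro continuous_diff M.cdf_is_right_cont N.cdf_is_right_cont)
  define D where "D = interval_measure F"
  define S where "S = measure_of UNIV (sets borel) (\<lambda>A. emeasure M A + emeasure D A)"
  have sets_S: "sets S = sets borel"
    by (simp add: S_def sets.sigma_sets_eq[of borel, simplified])
  have D: "sets D = sets borel" by (simp add: D_def)
  have S: "emeasure S A = emeasure M A + emeasure D A" if "A \<in> sets borel" for A
  proof (rule emeasure_measure_of[OF S_def])
    show "positive (sets S) (\<lambda>A. emeasure M A + emeasure D A)"
      by (simp add: positive_def)
    show "countably_additive (sets S) (\<lambda>A. emeasure M A + emeasure D A)"
    proof (rule countably_additiveI)
      fix A :: "nat \<Rightarrow> real set" assume A: "range A \<subseteq> sets S" "disjoint_family A"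
      have "(\<Sum>i. emeasure M (A i) + emeasure D (A i)) = (\<Sum>i. emeasure M (A i)) + (\<Sum>i. emeasure D (A i))"
        by (intro suminf_add[symmetric]) auto
      also have "\<dots> = emeasure M (\<Union>i. A i) + emeasure D (\<Union>i. A i)"
        using A D assms(3) by (intro arg_cong2[where f = "(+)"] suminf_emeasure) (auto simp: sets_S)
      finally show "(\<Sum>i. emeasure M (A i) + emeasure D (A i)) = emeasure M (\<Union>i. A i) + emeasure D (\<Union>i. A i)" .
    qed
  qed (use that sets_S in auto)
  have "N = S"
  proof (rule measure_eqI_generator_eq[where E = "range (\<lambda>(a, b). {a<..b::real})" and \<Omega> = UNIV
        and A = "\<lambda>n. {- real n<..real n}"])
    show "Int_stable (range (\<lambda>(a, b). {a<..b::real}))"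
      by (auto simp: Int_stable_def)
    show "emeasure N X = emeasure S X" if "X \<in> range (\<lambda>(a, b). {a<..b::real})" for X
    proof -
      from that obtain a b where X: "X = {a<..b}" by (auto simp: image_def)
      show ?thesis
      proof (cases "a \<le> b")
        case True
        have "emeasure S X = ennreal (measure M X) + ennreal (F b - F a)"
          using emeasure_interval_measure_Ioc[OF True F_mono F_rc]
          by (simp add: X S D_def M.emeasure_eq_measure)
        also have "\<dots> = ennreal (measure N X)"
          using F_diff[OF True] measure_le[OF True]
          by (simp add: X ennreal_plus[symmetric] del: ennreal_plus)
        finally show ?thesis by (simp add: N.emeasure_eq_measure)
      qed (simp add: X)
    qed
    have "sets (borel :: real measure) = sigma_sets UNIV (range (\<lambda>(a, b). {a<..b::real}))"
      by (subst borel_sigma_sets_Ioc) simp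
    then show "sets N = sigma_sets UNIV (range (\<lambda>(a, b). {a<..b::real}))"
      "sets S = sigma_sets UNIV (range (\<lambda>(a, b). {a<..b::real}))"
      using assms(4) sets_S by auto
    show "(\<Union>n. {- real n<..real n}) = UNIV" by (rule UN_Ioc_eq_UNIV)
  qed auto
  then show ?thesis using S[OF E] by simp
qed

text \<open>A density over \<open>lebesgue\<close> lives on the Lebesgue sets, whereas the
  comparison by intervals is for Borel measures. Pushing forward along the identity restricts the
  measure to the Borel sets.\<close>

lemma ex_borel_density:
  fixes f :: "real \<Rightarrow> real"
  assumes "integrable lebesgue f" "\<And>x. 0 \<le> f x"
  obtains \<nu> where "finite_measure \<nu>" "sets \<nu> = sets borel"
    "\<And>E. E \<in> sets borel \<Longrightarrow> emeasure \<nu> E = (\<integral>\<^sup>+x. ennreal (f x) * indicator E x \<partial>lebesgue)"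
proof -
  define D where "D = density lebesgue (\<lambda>x. ennreal (f x))"
  define \<nu> where "\<nu> = distr D borel (\<lambda>x. x)"
  have f [measurable]: "f \<in> borel_measurable lebesgue" using assms(1) by simp
  have meas: "(\<lambda>x. x) \<in> measurable D borel"
    unfolding D_def by (rule measurableI) auto
  have em: "emeasure \<nu> E = (\<integral>\<^sup>+x. ennreal (f x) * indicator E x \<partial>lebesgue)" if "E \<in> sets borel" for E
  proof -
    have "emeasure \<nu> E = emeasure D E"
      using emeasure_distr[OF meas that] by (simp add: \<nu>_def D_def)
    also have "\<dots> = (\<integral>\<^sup>+x. ennreal (f x) * indicator E x \<partial>lebesgue)"
      unfolding D_def using that by (intro emeasure_density) auto
    finally show ?thesis .
  qed
  have "finite_measure \<nu>"
  proof (rule finite_measureI)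
    have "emeasure \<nu> UNIV = (\<integral>\<^sup>+x. ennreal (f x) \<partial>lebesgue)" using em[of UNIV] by simp
    also have "\<dots> = ennreal (\<integral>x. f x \<partial>lebesgue)"
      using assms by (intro nn_integral_eq_integral) auto
    finally show "emeasure \<nu> (space \<nu>) \<noteq> \<infinity>" by (simp add: \<nu>_def)
  qed
  then show ?thesis using em by (intro that[of \<nu>]) (auto simp: \<nu>_def)
qed

lemma integral_Ioc: "integral {a<..b} f = integral {a..b::real} (f :: real \<Rightarrow> 'a::euclidean_space)"
proof (rule integral_spike_set)
  show "negligible {x \<in> {a<..b} - {a..b}. f x \<noteq> 0}"
    by (rule negligible_subset[of "{}"]) auto
  show "negligible {x \<in> {a..b} - {a<..b}. f x \<noteq> 0}"
    by (rule negligible_subset[of "{a}"]) auto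
qed

lemma nn_integral_Ioc:
  fixes f :: "real \<Rightarrow> real"
  assumes "integrable lebesgue f" "\<And>x. 0 \<le> f x"
  shows "(\<integral>\<^sup>+x. ennreal (f x) * indicator {a<..b} x \<partial>lebesgue) = ennreal (integral {a..b} f)"
proof -
  have int: "set_integrable lebesgue {a<..b} f"
    using assms(1) unfolding set_integrable_def by (intro integrable_mult_indicator) auto
  have "(\<integral>\<^sup>+x. ennreal (f x) * indicator {a<..b} x \<partial>lebesgue)
      = (\<integral>\<^sup>+x. ennreal (indicator {a<..b} x *\<^sub>R f x) \<partial>lebesgue)"
    by (intro nn_integral_cong) (auto simp: indicator_def)
  also have "\<dots> = ennreal (LINT x:{a<..b}|lebesgue. f x)"
    unfolding set_lebesgue_integral_def using int assms(2)
    by (intro nn_integral_eq_integral) (auto simp: set_integrable_def)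
  also have "(LINT x:{a<..b}|lebesgue. f x) = integral {a..b} f"
    using set_lebesgue_integral_eq_integral(2)[OF int] by (simp add: integral_Ioc)
  finally show ?thesis .
qed

text \<open>Composition with \<open>clamp_to T\<close> continues a function on \<open>{0..T}\<close>
  constantly to the real line. Stieltjes measures need such a continuation, and it puts no mass
  outside \<open>{0..T}\<close>.\<close>

definition clamp_to :: "real \<Rightarrow> real \<Rightarrow> real" where
  "clamp_to T t = max 0 (min T t)"

lemma clamp_to_in: "0 \<le> T \<Longrightarrow> clamp_to T t \<in> {0..T}"
  and clamp_to_id: "t \<in> {0..T} \<Longrightarrow> clamp_to T t = t"
  and clamp_to_mono: "s \<le> t \<Longrightarrow> clamp_to T s \<le> clamp_to T t"
  unfolding clamp_to_def by auto

lemma clamp_to_continuous: "continuous_on A (clamp_to T)"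
  unfolding clamp_to_def by (intro continuous_intros)

text \<open>Extending an integrand by zero matches the constant continuation of its
  primitive.\<close>

lemma integral_extend_zero:
  fixes h :: "real \<Rightarrow> 'a::euclidean_space"
  assumes "0 \<le> T" "a \<le> b"
  shows "integral {a..b} (\<lambda>x. indicator {0..T} x *\<^sub>R h x) = integral {clamp_to T a..clamp_to T b} h"
proof -
  have "(\<lambda>x. indicator {0..T} x *\<^sub>R h x) = (\<lambda>x. if x \<in> {0..T} then h x else 0)"
    by (auto simp: indicator_def)
  then have "integral {a..b} (\<lambda>x. indicator {0..T} x *\<^sub>R h x) = integral ({0..T} \<inter> {a..b}) h"
    by (simp only: Henstock_Kurzweil_Integration.integral_restrict_Int)
  also have "{0..T} \<inter> {a..b} = {max 0 a..min T b}" by auto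
  also have "integral {max 0 a..min T b} h = integral {clamp_to T a..clamp_to T b} h"
  proof (cases "max 0 a \<le> min T b")
    case True
    then show ?thesis by (simp add: clamp_to_def)
  next
    case False
    then have "{max 0 a..min T b} = {}" "clamp_to T a = clamp_to T b"
      using assms by (auto simp: clamp_to_def)
    then show ?thesis by simp
  qed
  finally show ?thesis .
qed

text \<open>The positive and negative parts of \<open>h\<close> are densities of two finite Borel
  measures. The hypothesis orders them on intervals, hence on all Borel sets. On the set where
  \<open>h\<close> is positive the negative part has no mass, so the positive part has none
  either.\<close>

lemma AE_nonpos_if_integrals_nonpos:
  fixes h :: "real \<Rightarrow> real"
  assumes T: "0 \<le> T" and h: "h absolutely_integrable_on {0..T}"
    and le: "\<And>a b. 0 \<le> a \<Longrightarrow> a \<le> b \<Longrightarrow> b \<le> T \<Longrightarrow> integral {a..b} h \<le> 0"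
  shows "AE t in lebesgue_on {0..T}. h t \<le> 0"
proof -
  define k where "k x = indicator {0..T} x *\<^sub>R h x" for x
  have k: "integrable lebesgue k" using h by (simp add: k_def[abs_def] set_integrable_def)
  have kp: "integrable lebesgue (\<lambda>x. max 0 (k x))" and kn: "integrable lebesgue (\<lambda>x. max 0 (- k x))"
    using k by auto
  obtain \<mu> where \<mu>: "finite_measure \<mu>" "sets \<mu> = sets borel"
    "\<And>E. E \<in> sets borel \<Longrightarrow> emeasure \<mu> E = (\<integral>\<^sup>+x. ennreal (max 0 (k x)) * indicator E x \<partial>lebesgue)"
    using ex_borel_density[OF kp] by auto
  obtain \<nu> where \<nu>: "finite_measure \<nu>" "sets \<nu> = sets borel"
    "\<And>E. E \<in> sets borel \<Longrightarrow> emeasure \<nu> E = (\<integral>\<^sup>+x. ennreal (max 0 (- k x)) * indicator E x \<partial>lebesgue)"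
    using ex_borel_density[OF kn] by auto
  have dom: "emeasure \<mu> E \<le> emeasure \<nu> E" if "E \<in> sets borel" for E
  proof (rule emeasure_le_if_Ioc_le[OF \<mu>(1) \<nu>(1) \<mu>(2) \<nu>(2) _ that])
    fix a b :: real assume ab: "a \<le> b"
    have int: "f integrable_on {a..b}" if "integrable lebesgue f" for f :: "real \<Rightarrow> real"
    proof (rule set_lebesgue_integral_eq_integral(1))
      show "set_integrable lebesgue {a..b} f"
        using that unfolding set_integrable_def by (intro integrable_mult_indicator) auto
    qed
    have "integral {a..b} (\<lambda>x. max 0 (k x)) - integral {a..b} (\<lambda>x. max 0 (- k x))
        = integral {a..b} (\<lambda>x. max 0 (k x) - max 0 (- k x))"
      by (intro Henstock_Kurzweil_Integration.integral_diff[symmetric] int kp kn)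
    also have "(\<lambda>x. max 0 (k x) - max 0 (- k x)) = k" by (auto simp: max_def)
    also have "integral {a..b} k = integral {clamp_to T a..clamp_to T b} h"
      unfolding k_def[abs_def] by (rule integral_extend_zero[OF T ab])
    also have "\<dots> \<le> 0"
      using clamp_to_in[OF T] clamp_to_mono[OF ab] by (intro le) auto
    finally show "emeasure \<mu> {a<..b} \<le> emeasure \<nu> {a<..b}"
      using nn_integral_Ioc[OF kp, of a b] nn_integral_Ioc[OF kn, of a b]
      by (simp add: \<mu>(3) \<nu>(3) ennreal_leI)
  qed
  \<comment> \<open>\<open>k\<close> is only Lebesgue measurable, so the set where it is positive
    need not be Borel; a Borel version differs from it on a null set.\<close>
  obtain k' where k': "k' \<in> borel_measurable lborel" and kk': "AE x in lborel. k x = k' x"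
    using completion_ex_borel_measurable_real[of k lborel] k by auto
  have kk': "AE x in lebesgue. k x = k' x" using kk' by (rule AE_completion)
  define E where "E = {x. k' x > 0}"
  have E: "E \<in> sets borel" using k' unfolding E_def by simp
  have "emeasure \<nu> E = (\<integral>\<^sup>+x. 0 \<partial>(lebesgue :: real measure))"
    unfolding \<nu>(3)[OF E]
    by (rule nn_integral_cong_AE, rule AE_mp[OF kk'], rule AE_I2) (auto simp: E_def indicator_def)
  with dom[OF E] have "(\<integral>\<^sup>+x. ennreal (max 0 (k x)) * indicator E x \<partial>lebesgue) = 0"
    by (simp add: \<mu>(3)[OF E])
  then have "AE x in lebesgue. ennreal (max 0 (k x)) * indicator E x = 0"
    using E borel_measurable_integrable[OF kp]
    by (subst (asm) nn_integral_0_iff_AE) (auto intro!: borel_measurable_times_ennreal borel_measurable_indicator)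
  with kk' have "AE x in lebesgue. k x \<le> 0"
    by eventually_elim (auto simp: E_def indicator_def max_def ennreal_eq_0_iff split: if_splits)
  then have "AE x in lebesgue. x \<in> {0..T} \<longrightarrow> h x \<le> 0"
    by eventually_elim (auto simp: k_def)
  then show ?thesis by (subst AE_restrict_space_iff) auto
qed

text \<open>Adding the control to \<open>u\<close> makes it nondecreasing. The Stieltjes measure of
  the sum is dominated by a measure with integrable density, hence absolutely continuous; its
  Radon-Nikodym density minus \<open>g\<close> is a derivative of \<open>u\<close>.\<close>

lemma ex_L1_derivative_real:
  fixes u g :: "real \<Rightarrow> real"
  assumes T: "0 \<le> T" and g: "g absolutely_integrable_on {0..T}"
    and u: "controlled_by {0..T} u (\<lambda>t. integral {0..t} g)"
  shows "\<exists>s. has_L1_derivative T u s"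
proof -
  define G where "G t = integral {0..t} g" for t
  have G_mono: "G x \<le> G y" if "x \<in> {0..T}" "y \<in> {0..T}" "x \<le> y" for x y
    using controlled_by_mono[OF u that] by (simp add: G_def)
  have G_cont: "continuous_on {0..T} G" unfolding G_def using g by (rule continuous_on_indefinite_integral)
  have u_cont: "continuous_on {0..T} u"
    using controlled_by_continuous_on[OF u] G_cont by (simp add: G_def[abs_def])
  define A where "A t = u (clamp_to T t) + G (clamp_to T t)" for t
  have A_bounds: "0 \<le> A y - A x \<and> A y - A x \<le> 2 * (G (clamp_to T y) - G (clamp_to T x))"
    if "x \<le> y" for x y
    using controlled_byD[OF u clamp_to_in[OF T] clamp_to_in[OF T] clamp_to_mono[OF that]]
    by (auto simp: A_def G_def)
  have A_mono: "A x \<le> A y" if "x \<le> y" for x y using A_bounds[OF that] by simp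
  have A_cont: "continuous_on UNIV A"
    unfolding A_def[abs_def]
    by (intro continuous_intros continuous_on_compose2[OF u_cont] continuous_on_compose2[OF G_cont]
        clamp_to_continuous) (use clamp_to_in[OF T] in auto)
  have A_rc: "continuous (at_right x) A" for x
    using A_cont by (meson UNIV_I continuous_on_eq_continuous_within continuous_within_subset subset_UNIV)
  define M where "M = interval_measure A"
  have M_Ioc: "emeasure M {a<..b} = ennreal (A b - A a)" if "a \<le> b" for a b
    unfolding M_def using that A_mono A_rc by (rule emeasure_interval_measure_Ioc)
  have M_sets: "sets M = sets borel" by (simp add: M_def)
  have M_fin: "finite_measure M"
  proof (rule finite_measureI)
    have "emeasure M (space M) = emeasure M (\<Union>n. {- real n<..real n})"
      by (simp add: UN_Ioc_eq_UNIV M_def)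
    also have "\<dots> = (SUP n. emeasure M {- real n<..real n})"
      by (intro SUP_emeasure_incseq[symmetric]) (auto simp: M_sets incseq_def)
    also have "\<dots> \<le> ennreal (2 * (G T - G 0))"
    proof (rule SUP_least)
      fix n :: nat
      have "A (real n) - A (- real n) \<le> 2 * (G (clamp_to T n) - G (clamp_to T (- real n)))"
        using A_bounds[of "- real n" "real n"] by simp
      also have "\<dots> \<le> 2 * (G T - G 0)"
        using T G_mono[of "clamp_to T n" T] G_mono[of 0 "clamp_to T (- real n)"]
          clamp_to_in[OF T, of n] clamp_to_in[OF T, of "- real n"] by simp
      finally show "emeasure M {- real n<..real n} \<le> ennreal (2 * (G T - G 0))"
        by (subst M_Ioc) (auto intro!: ennreal_leI)
    qed
    finally show "emeasure M (space M) \<noteq> \<infinity>" by (auto simp: top_unique)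
  qed
  \<comment> \<open>The hypothesis makes the integrals of \<open>g\<close> over intervals
    nonnegative, not every value of \<open>g\<close>; the absolute value gives a density that is
    nonnegative everywhere. The factor 2 is that of \<open>A_bounds\<close>.\<close>
  define k where "k x = indicator {0..T} x *\<^sub>R (2 * \<bar>g x\<bar>)" for x
  have g2: "(\<lambda>x. 2 * \<bar>g x\<bar>) absolutely_integrable_on {0..T}"
    using absolutely_integrable_norm[OF g, unfolded o_def]
    by (simp add: set_integrable_mult_right)
  have k: "integrable lebesgue k" using g2 by (simp add: k_def[abs_def] set_integrable_def)
  have k0: "0 \<le> k x" for x by (simp add: k_def)
  obtain \<nu> where \<nu>: "finite_measure \<nu>" "sets \<nu> = sets borel"
    "\<And>E. E \<in> sets borel \<Longrightarrow> emeasure \<nu> E = (\<integral>\<^sup>+x. ennreal (k x) * indicator E x \<partial>lebesgue)"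
    using ex_borel_density[OF k k0] by auto
  have dom: "emeasure M E \<le> emeasure \<nu> E" if "E \<in> sets borel" for E
  proof (rule emeasure_le_if_Ioc_le[OF M_fin \<nu>(1) M_sets \<nu>(2) _ that])
    fix a b :: real assume ab: "a \<le> b"
    let ?a = "clamp_to T a" and ?b = "clamp_to T b"
    have cl: "0 \<le> ?a" "?a \<le> ?b" "?b \<le> T" using clamp_to_in[OF T] clamp_to_mono[OF ab] by auto
    have "A b - A a \<le> 2 * (G ?b - G ?a)" using A_bounds[OF ab] by simp
    also have "\<dots> = 2 * integral {?a..?b} g"
      using integral_Icc_diff[OF g cl] by (simp add: G_def)
    also have "\<dots> = integral {?a..?b} (\<lambda>x. 2 * g x)" by simp
    also have "\<dots> \<le> integral {?a..?b} (\<lambda>x. 2 * \<bar>g x\<bar>)"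
      using abs_integrable_subinterval[OF g cl(1,3)] abs_integrable_subinterval[OF g2 cl(1,3)]
      by (intro integral_le) (auto simp: absolutely_integrable_on_def)
    also have "\<dots> = integral {a..b} k"
      unfolding k_def[abs_def] by (rule integral_extend_zero[OF T ab, symmetric])
    finally show "emeasure M {a<..b} \<le> emeasure \<nu> {a<..b}"
      using nn_integral_Ioc[OF k k0, of a b] by (simp add: M_Ioc[OF ab] \<nu>(3) ennreal_leI)
  qed
  have "absolutely_continuous lborel M"
    unfolding absolutely_continuous_def
  proof
    fix E :: "real set" assume E: "E \<in> null_sets lborel"
    then have Eb: "E \<in> sets borel" by (auto simp: null_sets_def)
    have "AE x in lborel. x \<notin> E" using E by (rule AE_not_in)
    then have "AE x in lebesgue. x \<notin> E" by (rule AE_completion)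
    then have "AE x in lebesgue. ennreal (k x) * indicator E x = 0"
      by eventually_elim (simp add: indicator_def)
    then have "emeasure \<nu> E = (\<integral>\<^sup>+x. 0 \<partial>(lebesgue :: real measure))"
      unfolding \<nu>(3)[OF Eb] by (rule nn_integral_cong_AE)
    with dom[OF Eb] have "emeasure M E = 0" by simp
    with Eb M_sets show "E \<in> null_sets M" by (simp add: null_sets_def)
  qed
  then obtain f where f [measurable]: "f \<in> borel_measurable lborel" and fM: "density lborel f = M"
    using sigma_finite_measure.Radon_Nikodym[OF sigma_finite_lborel, of M] M_sets by auto
  have M_eq: "emeasure M E = (\<integral>\<^sup>+x. f x * indicator E x \<partial>lborel)" if "E \<in> sets borel" for E
    using that unfolding fM[symmetric] by (intro emeasure_density) auto
  have f_fin: "(\<integral>\<^sup>+x. f x \<partial>lborel) \<noteq> \<infinity>"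
    using M_eq[of UNIV] finite_measure.emeasure_finite[OF M_fin, of UNIV] by simp
  then have f_AE: "AE x in lborel. f x \<noteq> \<infinity>" by (intro nn_integral_PInf_AE f)
  \<comment> \<open>\<open>f\<close> may be infinite on a null set, where \<open>enn2real\<close>
    returns 0.\<close>
  define s where "s x = enn2real (f x)" for x
  have s_meas [measurable]: "s \<in> borel_measurable borel" unfolding s_def using f by simp
  have f_s: "AE x in lborel. f x = ennreal (s x)"
    using f_AE by eventually_elim (simp add: s_def less_top)
  have s_int: "integrable lborel s"
  proof (rule integrableI_nonneg)
    have "(\<integral>\<^sup>+x. ennreal (s x) \<partial>lborel) = (\<integral>\<^sup>+x. f x \<partial>lborel)"
      by (rule nn_integral_cong_AE) (use f_s in eventually_elim, simp)
    with f_fin show "(\<integral>\<^sup>+x. ennreal (s x) \<partial>lborel) < \<infinity>" by (simp add: less_top)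
  qed (auto simp: s_def)
  have s_lint: "integrable lebesgue s" using s_int by (simp add: integrable_completion)
  have A_int: "A t - A 0 = integral {0..t} s" if t: "0 \<le> t" for t
  proof -
    have "ennreal (A t - A 0) = (\<integral>\<^sup>+x. f x * indicator {0<..t} x \<partial>lborel)"
      using M_Ioc[OF t] M_eq[of "{0<..t}"] by simp
    also have "\<dots> = (\<integral>\<^sup>+x. ennreal (s x) * indicator {0<..t} x \<partial>lborel)"
      by (rule nn_integral_cong_AE) (use f_s in eventually_elim, simp)
    also have "\<dots> = ennreal (integral {0..t} s)"
      using nn_integral_Ioc[OF s_lint, of 0 t] by (simp add: nn_integral_completion s_def)
    finally have eq: "ennreal (A t - A 0) = ennreal (integral {0..t} s)" .
    have "set_integrable lebesgue {0..t} s"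
      using s_lint unfolding set_integrable_def by (intro integrable_mult_indicator) auto
    then have "0 \<le> integral {0..t} s"
      by (intro Henstock_Kurzweil_Integration.integral_nonneg set_lebesgue_integral_eq_integral(1)) (auto simp: s_def)
    then show ?thesis using eq A_mono[OF t] by (simp add: ennreal_inj)
  qed
  have s_abs: "s absolutely_integrable_on {0..T}"
    using s_lint unfolding set_integrable_def by (intro integrable_mult_indicator) auto
  have "has_L1_derivative T u (\<lambda>x. s x - g x)"
  proof (rule L1_derivativeI)
    show "(\<lambda>x. s x - g x) absolutely_integrable_on {0..T}" using s_abs g by (rule set_integral_diff(1))
    fix t assume t: "0 \<le> t" "t \<le> T"
    have "u t - u 0 = A t - A 0 - integral {0..t} g"
      using t T by (simp add: A_def clamp_to_id G_def)
    also have "\<dots> = integral {0..t} s - integral {0..t} g" using A_int[OF t(1)] by simp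
    also have "\<dots> = integral {0..t} (\<lambda>x. s x - g x)"
      using abs_integrable_subinterval[OF s_abs _ t(2), of 0] abs_integrable_subinterval[OF g _ t(2), of 0]
      by (intro Henstock_Kurzweil_Integration.integral_diff[symmetric]) (auto simp: absolutely_integrable_on_def)
    finally show "u t - u 0 = integral {0..t} (\<lambda>x. s x - g x)" .
  qed
  then show ?thesis by blast
qed

text \<open>Each coordinate inherits the control of the norm, so the scalar case applies to
  it.\<close>

lemma ex_L1_derivative:
  fixes u :: "real \<Rightarrow> 'a::euclidean_space"
  assumes T: "0 \<le> T" and g: "g absolutely_integrable_on {0..T}"
    and u: "controlled_by {0..T} u (\<lambda>t. integral {0..t} g)"
  shows "\<exists>s. has_L1_derivative T u s"
proof -
  have "\<exists>s. has_L1_derivative T (\<lambda>t. u t \<bullet> b) s" if "b \<in> Basis" for b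
  proof (rule ex_L1_derivative_real[OF T g])
    show "controlled_by {0..T} (\<lambda>t. u t \<bullet> b) (\<lambda>t. integral {0..t} g)"
      unfolding controlled_by_def
    proof (intro ballI impI)
      fix x y assume "x \<in> {0..T}" "y \<in> {0..T}" "x \<le> y"
      then have "norm (u y - u x) \<le> integral {0..y} g - integral {0..x} g"
        by (rule controlled_byD[OF u])
      then show "norm (u y \<bullet> b - u x \<bullet> b) \<le> integral {0..y} g - integral {0..x} g"
        using Basis_le_norm[OF that, of "u y - u x"] by (simp add: inner_diff_left)
    qed
  qed
  then obtain s where s: "\<And>b. b \<in> Basis \<Longrightarrow> has_L1_derivative T (\<lambda>t. u t \<bullet> b) (s b)"
    by metis
  have s_abs: "s b absolutely_integrable_on {0..T}" if "b \<in> Basis" for b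
    using s[OF that] by (simp add: has_L1_derivative_def)
  have "has_L1_derivative T u (\<lambda>t. \<Sum>b\<in>Basis. s b t *\<^sub>R b)"
  proof (rule L1_derivativeI)
    have "(\<lambda>t. s b t *\<^sub>R b) absolutely_integrable_on {0..T}" if "b \<in> Basis" for b
      using s_abs[OF that] by (rule absolutely_integrable_scaleR_right)
    then show "(\<lambda>t. \<Sum>b\<in>Basis. s b t *\<^sub>R b) absolutely_integrable_on {0..T}"
      by (intro absolutely_integrable_sum) auto
    fix t assume t: "0 \<le> t" "t \<le> T"
    have int: "s b integrable_on {0..t}" if "b \<in> Basis" for b
      using abs_integrable_subinterval[OF s_abs[OF that], of 0 t] t by (simp add: absolutely_integrable_on_def)
    have "integral {0..t} (\<lambda>r. \<Sum>b\<in>Basis. s b r *\<^sub>R b) = (\<Sum>b\<in>Basis. integral {0..t} (\<lambda>r. s b r *\<^sub>R b))"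
      using int by (intro integral_sum integrable_on_scaleR_left) auto
    also have "\<dots> = (\<Sum>b\<in>Basis. ((u t - u 0) \<bullet> b) *\<^sub>R b)"
    proof (rule sum.cong)
      fix b :: 'a assume b: "b \<in> Basis"
      have "integral {0..t} (\<lambda>r. s b r *\<^sub>R b) = integral {0..t} (s b) *\<^sub>R b"
        by (intro integral_unique has_integral_scaleR_left integrable_integral int b)
      then show "integral {0..t} (\<lambda>r. s b r *\<^sub>R b) = ((u t - u 0) \<bullet> b) *\<^sub>R b"
        using L1_derivative_diff[OF s[OF b], of 0 t] t by (simp add: inner_diff_left)
    qed simp
    also have "\<dots> = u t - u 0" by (rule euclidean_representation)
    finally show "u t - u 0 = integral {0..t} (\<lambda>r. \<Sum>b\<in>Basis. s b r *\<^sub>R b)" by simp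
  qed
  then show ?thesis by blast
qed

subsection \<open>The sweeping process\<close>

text \<open>The last clause is the normal cone condition in integrated form, with the foot point
  frozen at the left end \<open>a\<close>; the quadratic term pays for the motion of
  \<open>\<sigma>\<close> between \<open>a\<close> and \<open>b\<close>. \<open>S\<close> is finite
  for the catching-up scheme and \<open>{0..T}\<close> for its limit.\<close>

definition sweeping_on ::
    "real set \<Rightarrow> 'a::euclidean_space set \<Rightarrow> (real \<Rightarrow> 'a) \<Rightarrow> (real \<Rightarrow> real) \<Rightarrow> (real \<Rightarrow> 'a) \<Rightarrow> bool" where
  "sweeping_on S C \<pi> G \<sigma> \<longleftrightarrow>
     \<sigma> 0 = closest_point C (\<pi> 0) \<and> (\<forall>t\<in>S. \<sigma> t \<in> C) \<and> controlled_by S \<sigma> G \<and>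
     (\<forall>a\<in>S. \<forall>b\<in>S. a \<le> b \<longrightarrow>
        (\<forall>z\<in>C. inner ((\<pi> b - \<sigma> b) - (\<pi> a - \<sigma> a)) (z - \<sigma> a) \<le> 2 * (G b - G a)\<^sup>2))"

text \<open>One catching-up step after the last time \<open>m\<close>. The projection is
  nonexpansive and fixes \<open>\<sigma> m\<close>, so the stress moves no more than the input; the
  residual of the projection is normal to \<open>C\<close> at the new stress
  \<open>c\<close>.\<close>

lemma sweeping_on_insert:
  assumes C: "C \<noteq> {}" "closed C" "convex C"
    and \<pi>: "controlled_by (insert b S) \<pi> G" and \<sigma>: "sweeping_on S C \<pi> G \<sigma>"
    and m: "m \<in> S" "\<And>x. x \<in> S \<Longrightarrow> x \<le> m" "m < b" and "b \<noteq> 0"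
  shows "sweeping_on (insert b S) C \<pi> G (\<sigma>(b := closest_point C (\<sigma> m + \<pi> b - \<pi> m)))"
proof -
  define c where "c = closest_point C (\<sigma> m + \<pi> b - \<pi> m)"
  define \<sigma>' where "\<sigma>' = \<sigma>(b := c)"
  have bS: "b \<notin> S" using m by fastforce
  have \<sigma>'S: "\<sigma>' x = \<sigma> x" if "x \<in> S" for x using bS that by (auto simp: \<sigma>'_def)
  have \<sigma>'b: "\<sigma>' b = c" by (simp add: \<sigma>'_def)
  have cC: "c \<in> C" unfolding c_def using C by (intro closest_point_in_set)
  have mC: "\<sigma> m \<in> C" using \<sigma> m by (simp add: sweeping_on_def)
  have \<pi>b: "norm (\<pi> b - \<pi> m) \<le> G b - G m" using controlled_byD[OF \<pi>, of m b] m by simp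
  have "norm (c - \<sigma> m) \<le> norm (\<pi> b - \<pi> m)"
    using closest_point_lipschitz[OF C(3,2,1), of "\<sigma> m + \<pi> b - \<pi> m" "\<sigma> m"] mC
    by (simp add: c_def closest_point_self dist_norm)
  then have cm: "norm (c - \<sigma> m) \<le> G b - G m" using \<pi>b by simp
  have \<sigma>_ctrl: "norm (\<sigma> y - \<sigma> x) \<le> G y - G x" if "x \<in> S" "y \<in> S" "x \<le> y" for x y
    using \<sigma> that by (auto simp: sweeping_on_def intro: controlled_byD)
  have cx: "norm (c - \<sigma> x) \<le> G b - G x" if "x \<in> S" for x
    using norm_triangle_ineq[of "c - \<sigma> m" "\<sigma> m - \<sigma> x"] cm \<sigma>_ctrl[of x m] m that by simp
  have dot: "inner ((\<pi> b - c) - (\<pi> x - \<sigma> x)) (z - \<sigma> x) \<le> 2 * (G b - G x)\<^sup>2" if "x \<in> S" "z \<in> C" for x z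
  proof -
    \<comment> \<open>\<open>d\<close> equals \<open>(\<sigma> m + \<pi> b - \<pi> m) - c\<close>,
      the residual of the projection. Input and stress each contribute at most
      \<open>G b - G m\<close> to its norm.\<close>
    define d where "d = (\<pi> b - c) - (\<pi> m - \<sigma> m)"
    have 1: "inner ((\<pi> m - \<sigma> m) - (\<pi> x - \<sigma> x)) (z - \<sigma> x) \<le> 2 * (G m - G x)\<^sup>2"
      using \<sigma> m that by (simp add: sweeping_on_def)
    have 2: "inner d (z - c) \<le> 0"
      using closest_point_dot[OF C(3,2) that(2), of "\<sigma> m + \<pi> b - \<pi> m"]
      by (simp add: d_def c_def algebra_simps)
    have "norm d \<le> norm (\<pi> b - \<pi> m) + norm (c - \<sigma> m)"
      unfolding d_def by (rule order_trans[OF _ norm_triangle_ineq4]) (simp add: algebra_simps)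
    then have "norm d \<le> 2 * (G b - G m)" using \<pi>b cm by simp
    then have "norm d * norm (c - \<sigma> x) \<le> 2 * (G b - G m) * (G b - G x)"
      using cx[OF that(1)] order_trans[OF norm_ge_zero cm] by (intro mult_mono) auto
    then have 3: "inner d (c - \<sigma> x) \<le> 2 * (G b - G m) * (G b - G x)"
      using norm_cauchy_schwarz[of d "c - \<sigma> x"] by simp
    have "(\<pi> b - c) - (\<pi> x - \<sigma> x) = ((\<pi> m - \<sigma> m) - (\<pi> x - \<sigma> x)) + d" by (simp add: d_def)
    moreover have "inner d (z - \<sigma> x) = inner d (z - c) + inner d (c - \<sigma> x)"
      by (simp add: inner_diff_right)
    ultimately have "inner ((\<pi> b - c) - (\<pi> x - \<sigma> x)) (z - \<sigma> x)
        = inner ((\<pi> m - \<sigma> m) - (\<pi> x - \<sigma> x)) (z - \<sigma> x) + (inner d (z - c) + inner d (c - \<sigma> x))"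
      by (simp only: inner_add_left)
    also have "\<dots> \<le> 2 * (G m - G x)\<^sup>2 + 2 * (G b - G m) * (G b - G x)"
      using 1 2 3 by simp
    \<comment> \<open>The quadratic bound reproduces itself here: with u = \<open>G m - G x\<close>
      and v = \<open>G b - G m\<close>, the old and the new error add up to 2 u^2 + 2 v (u + v),
      which is 2 u v less than 2 (u + v)^2.\<close>
    also have "\<dots> = 2 * (G b - G x)\<^sup>2 - 2 * ((G m - G x) * (G b - G m))"
      by (simp add: power2_eq_square algebra_simps)
    also have "\<dots> \<le> 2 * (G b - G x)\<^sup>2"
      using \<sigma>_ctrl[of x m] \<pi>b m that norm_ge_zero[of "\<sigma> m - \<sigma> x"] norm_ge_zero[of "\<pi> b - \<pi> m"]
      by (simp del: norm_ge_zero)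
    finally show ?thesis .
  qed
  have le: "y \<in> S \<Longrightarrow> \<not> b \<le> y" for y using m by fastforce
  have "sweeping_on (insert b S) C \<pi> G \<sigma>'"
    unfolding sweeping_on_def controlled_by_def
  proof (intro conjI ballI impI)
    show "\<sigma>' 0 = closest_point C (\<pi> 0)" using \<sigma> \<open>b \<noteq> 0\<close> by (simp add: \<sigma>'_def sweeping_on_def)
    show "\<sigma>' t \<in> C" if "t \<in> insert b S" for t
      using that cC \<sigma> \<sigma>'S \<sigma>'b by (auto simp: sweeping_on_def)
    fix x y assume xy: "x \<in> insert b S" "y \<in> insert b S" "x \<le> y"
    show "norm (\<sigma>' y - \<sigma>' x) \<le> G y - G x"
      using xy cx \<sigma>_ctrl le by (auto simp: \<sigma>'S \<sigma>'b)
    fix z assume z: "z \<in> C"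
    have "inner ((\<pi> y - \<sigma> y) - (\<pi> x - \<sigma> x)) (z - \<sigma> x) \<le> 2 * (G y - G x)\<^sup>2" if "x \<in> S" "y \<in> S"
      using \<sigma> that xy z by (simp add: sweeping_on_def)
    then show "inner ((\<pi> y - \<sigma>' y) - (\<pi> x - \<sigma>' x)) (z - \<sigma>' x) \<le> 2 * (G y - G x)\<^sup>2"
      using xy z dot le by (auto simp: \<sigma>'S \<sigma>'b)
  qed
  then show ?thesis by (simp add: \<sigma>'_def c_def)
qed

text \<open>Times are added in increasing order, so each new one lies to the right of all earlier
  ones, as a catching-up step requires.\<close>

lemma ex_sweeping_on_finite:
  assumes C: "C \<noteq> {}" "closed C" "convex C" and \<pi>: "controlled_by {0..T} \<pi> G"
    and B: "finite B" "B \<subseteq> {0<..T}" and T: "0 \<le> T"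
  shows "\<exists>\<sigma>. sweeping_on (insert 0 B) C \<pi> G \<sigma>"
  using B
proof (induction B rule: finite_linorder_max_induct)
  case empty
  have "sweeping_on {0} C \<pi> G (\<lambda>_. closest_point C (\<pi> 0))"
    using C by (simp add: sweeping_on_def controlled_by_def closest_point_in_set)
  then show ?case by blast
next
  case (insert b B)
  then obtain \<sigma> where \<sigma>: "sweeping_on (insert 0 B) C \<pi> G \<sigma>" by auto
  define m where "m = Max (insert 0 B)"
  have m: "m \<in> insert 0 B" "\<And>x. x \<in> insert 0 B \<Longrightarrow> x \<le> m"
    unfolding m_def using insert.hyps by (intro Max_in Max_ge; simp)+
  have "m < b" using m(1) insert by auto
  moreover have "controlled_by (insert b (insert 0 B)) \<pi> G"
    using insert.prems T by (intro controlled_by_subset[OF \<pi>]) force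
  ultimately have "sweeping_on (insert b (insert 0 B)) C \<pi> G (\<sigma>(b := closest_point C (\<sigma> m + \<pi> b - \<pi> m)))"
    using insert.prems by (intro sweeping_on_insert[OF C _ \<sigma> m]) auto
  then show ?case by (auto simp: insert_commute)
qed

text \<open>Every constraint in \<^const>\<open>sweeping_on\<close> is a closed condition on two values of \<open>\<sigma>\<close>, and the
  values range over a fixed ball, so Tychonoff's theorem passes from finite sets to \<open>[0,T]\<close>.\<close>
lemma ex_sweeping_on_interval:
  fixes C :: "'a::euclidean_space set"
  assumes C: "C \<noteq> {}" "closed C" "convex C" and \<pi>: "controlled_by {0..T} \<pi> G" and T: "0 \<le> T"
  shows "\<exists>\<sigma>. sweeping_on {0..T} C \<pi> G \<sigma>"
proof -
  define c where "c = closest_point C (\<pi> 0)"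
  \<comment> \<open>The control bounds the distance from the starting value by the total increment
    of \<open>G\<close>, which gives one compact ball for all times.\<close>
  define B where "B = cball c (G T - G 0)"
  define K where "K = (PiE UNIV (\<lambda>_. B) :: (real \<Rightarrow> 'a) set)"
  define I where "I = {(a, b). a \<in> {0..T} \<and> b \<in> {0..T} \<and> a \<le> b}"
  define F where "F = (\<lambda>(a, b). {f :: real \<Rightarrow> 'a. f 0 = c \<and> f a \<in> C \<and> norm (f b - f a) \<le> G b - G a \<and>
      (\<forall>z\<in>C. inner ((\<pi> b - f b) - (\<pi> a - f a)) (z - f a) \<le> 2 * (G b - G a)\<^sup>2)})"
  have "compactin (product_topology (\<lambda>_::real. euclidean :: 'a topology) UNIV) K"
    unfolding K_def compactin_PiE B_def by simp
  then have "compact K" by (simp add: euclidean_product_topology)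
  then have "K \<inter> (\<Inter>i\<in>I. F i) \<noteq> {}"
  proof (rule compact_imp_fip_image)
    fix i assume "i \<in> I"
    obtain a b where i: "i = (a, b)" by (cases i)
    have F: "F i = {f. f 0 = c} \<inter> (\<lambda>f. f a) -` C \<inter> {f. norm (f b - f a) \<le> G b - G a} \<inter>
        (\<Inter>z\<in>C. {f. inner ((\<pi> b - f b) - (\<pi> a - f a)) (z - f a) \<le> 2 * (G b - G a)\<^sup>2})"
      unfolding F_def i by auto
    show "closed (F i)"
      unfolding F
    proof (intro closed_Int closed_INT ballI closed_Collect_le closed_Collect_eq closed_vimage continuous_intros)
    qed (use C in auto)
  next
    fix J assume J: "finite J" "J \<subseteq> I"
    define A where "A = (fst ` J \<union> snd ` J) - {0}"
    have A: "finite A" "A \<subseteq> {0<..T}" using J by (auto simp: A_def I_def)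
    obtain \<sigma> where \<sigma>: "sweeping_on (insert 0 A) C \<pi> G \<sigma>"
      using ex_sweeping_on_finite[OF C \<pi> A T] by blast
    \<comment> \<open>The scheme prescribes nothing at the other times; the value \<open>c\<close>
      there keeps \<open>f\<close> in the product of balls.\<close>
    define f where "f t = (if t \<in> insert 0 A then \<sigma> t else c)" for t
    have \<sigma>0: "\<sigma> 0 = c" using \<sigma> by (simp add: sweeping_on_def c_def)
    have "f t \<in> B" for t
    proof (cases "t \<in> insert 0 A")
      case True
      then have "norm (\<sigma> t - c) \<le> G t - G 0"
        using \<sigma> A \<sigma>0 controlled_byD[of "insert 0 A" \<sigma> G 0 t] by (auto simp: sweeping_on_def)
      also have "\<dots> \<le> G T - G 0" using controlled_by_mono[OF \<pi>, of t T] True A T by auto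
      finally show ?thesis using True by (auto simp: f_def B_def dist_norm norm_minus_commute)
    next
      case False
      then show ?thesis using controlled_by_mono[OF \<pi>, of 0 T] T by (auto simp: f_def B_def)
    qed
    then have "f \<in> K" by (simp add: K_def PiE_iff)
    moreover have "f \<in> F i" if "i \<in> J" for i
    proof -
      obtain a b where i: "i = (a, b)" by (cases i)
      have "a \<in> insert 0 A" "b \<in> insert 0 A" "a \<le> b"
        using that i J by (force simp: A_def I_def)+
      then show ?thesis
        using \<sigma> \<sigma>0 by (auto simp: F_def i f_def sweeping_on_def intro: controlled_byD)
    qed
    ultimately show "K \<inter> (\<Inter>i\<in>J. F i) \<noteq> {}" by blast
  qed
  then obtain f where f: "\<And>i. i \<in> I \<Longrightarrow> f \<in> F i" by blast
  have "sweeping_on {0..T} C \<pi> G f"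
    unfolding sweeping_on_def controlled_by_def
  proof (intro conjI ballI impI)
    show "f 0 = closest_point C (\<pi> 0)" using f[of "(0, 0)"] T by (auto simp: I_def F_def c_def)
    show "f t \<in> C" if "t \<in> {0..T}" for t using f[of "(t, t)"] that by (auto simp: I_def F_def)
    fix x y assume xy: "x \<in> {0..T}" "y \<in> {0..T}" "x \<le> y"
    then show "norm (f y - f x) \<le> G y - G x" using f[of "(x, y)"] by (auto simp: I_def F_def)
    fix z assume "z \<in> C"
    then show "inner ((\<pi> y - f y) - (\<pi> x - f x)) (z - f x) \<le> 2 * (G y - G x)\<^sup>2"
      using xy f[of "(x, y)"] by (auto simp: I_def F_def)
  qed
  then show ?thesis by blast
qed

section \<open>From the two-time inequality to the differential inclusion\<close>

lemma integral_inner_const: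
  fixes f :: "real \<Rightarrow> 'a::euclidean_space"
  assumes "f integrable_on S"
  shows "(\<lambda>r. inner (f r) c) integrable_on S" "integral S (\<lambda>r. inner (f r) c) = inner (integral S f) c"
  using integrable_linear[OF assms bounded_linear_inner_left[of c]]
    integral_linear[OF assms bounded_linear_inner_left[of c]] by (simp_all add: o_def)

lemma absolutely_integrable_inner_continuous:
  fixes f u :: "real \<Rightarrow> 'a::euclidean_space"
  assumes "f absolutely_integrable_on {0..T}" "continuous_on {0..T} u"
  shows "(\<lambda>r. inner (f r) (u r)) absolutely_integrable_on {0..T}"
proof -
  have "(\<lambda>r. inner (u r) (f r)) absolutely_integrable_on {0..T}"
  proof (rule absolutely_integrable_bounded_measurable_product[where h = inner and f = u, OF _ _ _ _ assms(1)])
    show "bilinear (inner :: 'a \<Rightarrow> 'a \<Rightarrow> real)"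
      by (simp add: bilinear_conv_bounded_bilinear bounded_bilinear_inner)
    show "u \<in> borel_measurable (lebesgue_on {0..T})"
      using assms(2) by (rule continuous_imp_measurable_on_sets_lebesgue) auto
    show "bounded (u ` {0..T})"
      using assms(2) by (intro compact_imp_bounded compact_continuous_image) auto
  qed auto
  then show ?thesis by (simp add: inner_commute)
qed

lemma has_L1_derivative_diff:
  assumes "has_L1_derivative T u f" "has_L1_derivative T v g"
  shows "has_L1_derivative T (\<lambda>t. u t - v t) (\<lambda>t. f t - g t)"
proof (rule L1_derivativeI)
  have abs: "f absolutely_integrable_on {0..T}" "g absolutely_integrable_on {0..T}"
    using assms by (auto simp: has_L1_derivative_def)
  then show "(\<lambda>t. f t - g t) absolutely_integrable_on {0..T}" by (rule set_integral_diff(1))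
  fix t assume t: "0 \<le> t" "t \<le> T"
  have "integral {0..t} (\<lambda>t. f t - g t) = integral {0..t} f - integral {0..t} g"
    using abs_integrable_subinterval[OF abs(1), of 0 t] abs_integrable_subinterval[OF abs(2), of 0 t] t
    by (intro Henstock_Kurzweil_Integration.integral_diff) (auto simp: absolutely_integrable_on_def)
  moreover have "u t - v t - (u 0 - v 0) = (u t - u 0) - (v t - v 0)" by simp
  ultimately show "u t - v t - (u 0 - v 0) = integral {0..t} (\<lambda>t. f t - g t)"
    using L1_derivative_diff[OF assms(1), of 0 t] L1_derivative_diff[OF assms(2), of 0 t] t by (simp only:)
qed

lemma has_L1_derivative_continuous_on:
  assumes "has_L1_derivative T u g"
  shows "continuous_on {0..T} u"
proof -
  have "g absolutely_integrable_on {0..T}" using assms by (simp add: has_L1_derivative_def)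
  then show ?thesis
    by (intro controlled_by_continuous_on[OF controlled_by_integral_norm[OF assms]]
        continuous_on_indefinite_integral absolutely_integrable_norm[unfolded o_def])
qed

lemma AE_lebesgue_on_iff:
  "S \<in> sets lebesgue \<Longrightarrow> (AE t in lebesgue_on S. P t) \<longleftrightarrow> (AE t in lebesgue. t \<in> S \<longrightarrow> P t)"
  by (intro AE_restrict_space_iff) simp

text \<open>For fixed \<open>z\<close>, freezing \<open>\<sigma>\<close> at the left end of an
  interval costs a product of two increments, so the integral of
  \<open>inner (q t) (z - \<sigma> t)\<close> is nonincreasing and the integrand is nonpositive
  almost everywhere. The control by the variation of the input is kept in the conclusion because the
  upper bound rests on it.\<close>

lemma ex_sweeping_solution:
  fixes C :: "'a::euclidean_space set"
  assumes T: "T > 0" and C: "C \<noteq> {}" "closed C" "convex C" and \<pi>: "\<pi> \<in> W11 T"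
  shows "\<exists>\<sigma>. sweeping_solution T C \<pi> \<sigma> \<and> controlled_by {0..T} \<sigma> (variation \<pi> 0)"
proof -
  obtain p where p: "has_L1_derivative T \<pi> p" using \<pi> by (rule W11_derivativeE)
  define G where "G = variation \<pi> 0"
  obtain \<sigma>0 where \<sigma>0: "sweeping_on {0..T} C \<pi> G \<sigma>0"
    using ex_sweeping_on_interval[OF C W11_controlled_by_variation[OF \<pi>]] T by (auto simp: G_def)
  \<comment> \<open>The limit is arbitrary outside \<open>{0..T}\<close>, whereas \<open>W11\<close>
    asks for an extensional function.\<close>
  define \<sigma> where "\<sigma> = restrict \<sigma>0 {0..T}"
  have \<sigma>: "sweeping_on {0..T} C \<pi> G \<sigma>"
    using \<sigma>0 T by (auto simp: sweeping_on_def controlled_by_def \<sigma>_def)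
  \<comment> \<open>\<open>G\<close> is a variation; \<open>P\<close>, which dominates its
    increments, is a primitive of an integrable function, as \<open>ex_L1_derivative\<close> demands
    of a control.\<close>
  define P where "P t = integral {0..t} (\<lambda>r. norm (p r))" for t
  have p_abs: "p absolutely_integrable_on {0..T}" using p by (simp add: has_L1_derivative_def)
  then have np: "(\<lambda>r. norm (p r)) absolutely_integrable_on {0..T}"
    by (rule absolutely_integrable_norm[unfolded o_def])
  have GP: "G y - G x \<le> P y - P x" if "x \<in> {0..T}" "y \<in> {0..T}" "x \<le> y" for x y
    using variation_diff_le[OF controlled_by_integral_norm[OF p] that] by (simp add: G_def P_def)
  have G_mono: "G x \<le> G y" if "x \<in> {0..T}" "y \<in> {0..T}" "x \<le> y" for x y
    using controlled_by_mono[OF W11_controlled_by_variation[OF \<pi>] that] by (simp add: G_def)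
  have \<sigma>G: "controlled_by {0..T} \<sigma> G" using \<sigma> by (simp add: sweeping_on_def)
  have \<sigma>P: "controlled_by {0..T} \<sigma> P"
    using controlled_byD[OF \<sigma>G] GP unfolding controlled_by_def by force
  obtain s where s: "has_L1_derivative T \<sigma> s"
    using ex_L1_derivative[OF _ np] \<sigma>P T by (auto simp: P_def[abs_def])
  define q where "q t = p t - s t" for t
  have q: "has_L1_derivative T (\<lambda>t. \<pi> t - \<sigma> t) q"
    unfolding q_def[abs_def] by (rule has_L1_derivative_diff[OF p s])
  have q_abs: "q absolutely_integrable_on {0..T}" using q by (simp add: has_L1_derivative_def)
  then have nq: "(\<lambda>r. norm (q r)) absolutely_integrable_on {0..T}"
    by (rule absolutely_integrable_norm[unfolded o_def])
  define Q where "Q t = integral {0..t} (\<lambda>r. norm (q r))" for t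
  have \<sigma>_cont: "continuous_on {0..T} \<sigma>" using s by (rule has_L1_derivative_continuous_on)
  have AE_z: "AE t in lebesgue_on {0..T}. inner (q t) (z - \<sigma> t) \<le> 0" if z: "z \<in> C" for z
  proof (rule AE_nonpos_if_integrals_nonpos)
    let ?h = "\<lambda>t. inner (q t) (z - \<sigma> t)"
    show h: "?h absolutely_integrable_on {0..T}"
      by (intro absolutely_integrable_inner_continuous q_abs continuous_intros \<sigma>_cont)
    fix a b assume ab: "0 \<le> a" "a \<le> b" "b \<le> T"
    define H where "H t = integral {0..t} ?h" for t
    have "H b \<le> H a"
    \<comment> \<open>The error consists of the squared increment of \<open>P\<close> and the
      product of the increments of \<open>P\<close> and \<open>Q\<close>; the square of the
      increment of \<open>P + Q\<close> absorbs both.\<close>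
    proof (rule nonincreasing_if_quadratic_bound[where H = H and a = a and b = b and G = "\<lambda>t. P t + Q t" and K = 2])
      have "continuous_on {0..T} P" "continuous_on {0..T} Q"
        unfolding P_def[abs_def] Q_def[abs_def] using np nq by (auto intro: continuous_on_indefinite_integral)
      then show "continuous_on {a..b} (\<lambda>t. P t + Q t)"
        using ab by (intro continuous_intros) (auto intro: continuous_on_subset)
      fix x y assume xy: "a \<le> x" "x \<le> y" "y \<le> b"
      then have xyT: "0 \<le> x" "x \<le> y" "y \<le> T" "x \<in> {0..T}" "y \<in> {0..T}" using ab by auto
      have int: "f integrable_on {x..y}" if "f absolutely_integrable_on {0..T}" for f :: "real \<Rightarrow> 'b::euclidean_space"
        using abs_integrable_subinterval[OF that xyT(1,3)] by (simp add: absolutely_integrable_on_def)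
      have P: "0 \<le> P y - P x" using GP[OF xyT(4,5,2)] G_mono[OF xyT(4,5,2)] by simp
      have Qd: "Q y - Q x = integral {x..y} (\<lambda>r. norm (q r))"
        using integral_Icc_diff[OF nq xyT(1-3)] by (simp add: Q_def)
      then have Q: "0 \<le> Q y - Q x" using int[OF nq] by (simp add: Henstock_Kurzweil_Integration.integral_nonneg)
      have "H y - H x = integral {x..y} ?h"
        using integral_Icc_diff[OF h xyT(1-3)] by (simp add: H_def)
      also have "\<dots> \<le> integral {x..y} (\<lambda>r. inner (q r) (z - \<sigma> x) + norm (q r) * (P y - P x))"
      proof (rule integral_le)
        show "?h integrable_on {x..y}" using h by (rule int)
        show "(\<lambda>r. inner (q r) (z - \<sigma> x) + norm (q r) * (P y - P x)) integrable_on {x..y}"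
          using int[OF q_abs] int[OF nq] by (intro integrable_add integral_inner_const integrable_on_mult_left)
        fix r assume r: "r \<in> {x..y}"
        have "inner (q r) (\<sigma> x - \<sigma> r) \<le> norm (q r) * norm (\<sigma> x - \<sigma> r)" by (rule norm_cauchy_schwarz)
        also have "norm (\<sigma> x - \<sigma> r) \<le> P r - P x"
          using controlled_byD[OF \<sigma>P, of x r] r xyT by (simp add: norm_minus_commute)
        also have "\<dots> \<le> P y - P x" using controlled_by_mono[OF \<sigma>P, of r y] r xyT by simp
        finally show "?h r \<le> inner (q r) (z - \<sigma> x) + norm (q r) * (P y - P x)"
          by (simp add: inner_diff_right mult_left_mono)
      qed
      also have "\<dots> = inner (integral {x..y} q) (z - \<sigma> x) + (Q y - Q x) * (P y - P x)"
        using int[OF q_abs] int[OF nq]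
        by (subst integral_add) (auto simp: integral_inner_const Qd intro: integral_inner_const integrable_on_mult_left)
      also have "integral {x..y} q = (\<pi> y - \<sigma> y) - (\<pi> x - \<sigma> x)"
        using L1_derivative_diff[OF q xyT(1-3)] by simp
      also have "inner ((\<pi> y - \<sigma> y) - (\<pi> x - \<sigma> x)) (z - \<sigma> x) \<le> 2 * (G y - G x)\<^sup>2"
        using \<sigma> xyT z by (simp add: sweeping_on_def)
      also have "(G y - G x)\<^sup>2 \<le> (P y - P x)\<^sup>2"
        using GP[OF xyT(4,5,2)] G_mono[OF xyT(4,5,2)] by (intro power_mono) auto
      also have "2 * (P y - P x)\<^sup>2 + (Q y - Q x) * (P y - P x) \<le> 2 * ((P y + Q y) - (P x + Q x))\<^sup>2"
      proof -
        have "2 * u\<^sup>2 + v * u \<le> 2 * (u + v)\<^sup>2" if "0 \<le> u" "0 \<le> v" for u v :: real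
          using mult_nonneg_nonneg[OF that] by (simp add: power2_eq_square algebra_simps)
        from this[OF P Q] show ?thesis by (simp add: algebra_simps)
      qed
      finally show "P x + Q x \<le> P y + Q y \<and> H y - H x \<le> 2 * ((P y + Q y) - (P x + Q x))\<^sup>2"
        using P Q by simp
    qed (use ab in auto)
    then show "integral {a..b} ?h \<le> 0" using integral_Icc_diff[OF h ab] by (simp add: H_def)
  qed (use T in auto)
  \<comment> \<open>The exceptional null set depends on \<open>z\<close>. Countably many
    \<open>z\<close> share one, and continuity in \<open>z\<close> extends the inequality from
    \<open>D\<close> to its closure.\<close>
  obtain D where D: "countable D" "D \<subseteq> C" "C \<subseteq> closure D" using separable by blast
  have "AE t in lebesgue_on {0..T}. \<forall>z\<in>D. inner (q t) (z - \<sigma> t) \<le> 0"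
    using D AE_z by (subst AE_ball_countable) auto
  then have "AE t in lebesgue_on {0..T}. q t \<in> normal_cone C (\<sigma> t)"
  proof eventually_elim
    case (elim t)
    have "closed {z. inner (q t) (z - \<sigma> t) \<le> 0}" by (intro closed_Collect_le continuous_intros)
    with elim have "closure D \<subseteq> {z. inner (q t) (z - \<sigma> t) \<le> 0}" by (intro closure_minimal) auto
    with D(3) show ?case by (auto simp: normal_cone_def)
  qed
  then have "AE t in lebesgue_on {0<..<T}. q t \<in> normal_cone C (\<sigma> t)"
    using AE_lebesgue_on_iff[of "{0<..<T}"] AE_lebesgue_on_iff[of "{0..T}"]
    by simp (auto elim: eventually_mono)
  moreover have "\<sigma> \<in> W11_in T C"
    using s \<sigma> by (auto simp: W11_in_def W11_def \<sigma>_def sweeping_on_def)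
  ultimately have "sweeping_solution T C \<pi> \<sigma>"
    using p s \<sigma> unfolding sweeping_solution_def sweeping_on_def q_def by blast
  with \<sigma>G show ?thesis by (auto simp: G_def)
qed

text \<open>Monotonicity of the normal cone makes \<open>inner (q t) (w t)\<close> nonpositive
  almost everywhere, where \<open>w\<close> is the difference of the solutions and \<open>q\<close>
  its derivative. So the squared distance cannot grow from its initial value zero.\<close>

lemma sweeping_solution_unique:
  fixes C :: "'a::euclidean_space set"
  assumes T: "T > 0" and sol: "sweeping_solution T C \<pi> \<sigma>1" "sweeping_solution T C \<pi> \<sigma>2"
  shows "\<sigma>1 = \<sigma>2"
proof -
  obtain p1 s1 where 1: "has_L1_derivative T \<pi> p1" "has_L1_derivative T \<sigma>1 s1"
    "AE t in lebesgue_on {0<..<T}. p1 t - s1 t \<in> normal_cone C (\<sigma>1 t)"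
    using sol(1) unfolding sweeping_solution_def by blast
  obtain p2 s2 where 2: "has_L1_derivative T \<pi> p2" "has_L1_derivative T \<sigma>2 s2"
    "AE t in lebesgue_on {0<..<T}. p2 t - s2 t \<in> normal_cone C (\<sigma>2 t)"
    using sol(2) unfolding sweeping_solution_def by blast
  have inC: "\<sigma>1 t \<in> C" "\<sigma>2 t \<in> C" if "t \<in> {0..T}" for t
    using sol that by (auto simp: sweeping_solution_def W11_in_def)
  define w where "w t = \<sigma>2 t - \<sigma>1 t" for t
  \<comment> \<open>\<open>p1\<close> and \<open>p2\<close> are both derivatives of
    \<open>\<pi>\<close> but may differ on a null set, so both are kept; the input itself cancels in
    \<open>w\<close>.\<close>
  define q where "q t = (p1 t - s1 t) - (p2 t - s2 t)" for t
  have "has_L1_derivative T (\<lambda>t. (\<pi> t - \<sigma>1 t) - (\<pi> t - \<sigma>2 t)) q"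
    unfolding q_def[abs_def] by (intro has_L1_derivative_diff 1 2)
  then have q: "has_L1_derivative T w q" by (simp add: w_def[abs_def])
  have q_abs: "q absolutely_integrable_on {0..T}" using q by (simp add: has_L1_derivative_def)
  then have nq: "(\<lambda>r. norm (q r)) absolutely_integrable_on {0..T}"
    by (rule absolutely_integrable_norm[unfolded o_def])
  define Q where "Q t = integral {0..t} (\<lambda>r. norm (q r))" for t
  have wQ: "controlled_by {0..T} w Q" unfolding Q_def[abs_def] using q by (rule controlled_by_integral_norm)
  have AE0: "AE t in lebesgue. t \<in> {0<..<T} \<longrightarrow> inner (q t) (w t) \<le> 0"
  proof -
    have *: "AE t in lebesgue. t \<in> {0<..<T} \<longrightarrow> p1 t - s1 t \<in> normal_cone C (\<sigma>1 t)"
      "AE t in lebesgue. t \<in> {0<..<T} \<longrightarrow> p2 t - s2 t \<in> normal_cone C (\<sigma>2 t)"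
      using 1(3) 2(3) AE_lebesgue_on_iff[of "{0<..<T}"] by simp_all
    then show ?thesis
    proof eventually_elim
      case (elim t)
      show ?case
      proof
        assume t: "t \<in> {0<..<T}"
        with elim inC[of t] have "inner (p1 t - s1 t) (\<sigma>2 t - \<sigma>1 t) \<le> 0"
          "inner (p2 t - s2 t) (\<sigma>1 t - \<sigma>2 t) \<le> 0"
          by (auto simp: normal_cone_def)
        then show "inner (q t) (w t) \<le> 0"
          by (simp add: q_def w_def inner_diff_left inner_diff_right)
      qed
    qed
  qed
  have AE_w: "AE t in lebesgue. t \<in> {0..T} \<longrightarrow> inner (q t) (w t) \<le> 0"
  proof -
    have "{0, T} \<in> null_sets lborel" by (intro finite_imp_null_set_lborel) auto
    then have "AE t in lebesgue. t \<notin> {0, T}" by (intro AE_completion AE_not_in)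
    with AE0 show ?thesis by eventually_elim (auto simp: less_le)
  qed
  have w0: "w t = 0" if t: "t \<in> {0..T}" for t
  proof -
    define H where "H r = inner (w r) (w r)" for r
    have "H t \<le> H 0"
    proof (rule nonincreasing_if_quadratic_bound[where H = H and a = 0 and b = t and G = Q and K = 2])
      have "continuous_on {0..T} Q" unfolding Q_def[abs_def] using nq by (rule continuous_on_indefinite_integral)
      then show "continuous_on {0..t} Q" using t by (auto intro: continuous_on_subset)
      fix x y assume xy: "0 \<le> x" "x \<le> y" "y \<le> t"
      then have xyT: "0 \<le> x" "x \<le> y" "y \<le> T" "x \<in> {0..T}" "y \<in> {0..T}" using t by auto
      have sub: "f absolutely_integrable_on {x..y}" if "f absolutely_integrable_on {0..T}"
        for f :: "real \<Rightarrow> 'b::euclidean_space"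
        by (rule abs_integrable_subinterval[OF that xyT(1,3)])
      have int: "q integrable_on {x..y}" using sub[OF q_abs] by (simp add: absolutely_integrable_on_def)
      have i1: "(\<lambda>r. inner (q r) (w x + w y)) absolutely_integrable_on {x..y}"
        by (intro sub absolutely_integrable_inner_continuous q_abs continuous_intros)
      have i2: "(\<lambda>r. norm (q r) * (2 * (Q y - Q x))) absolutely_integrable_on {x..y}"
        using sub[OF nq] by simp
      \<comment> \<open>This identity takes the place of the product rule. Under the integral,
        \<open>w x + w y\<close> differs from twice \<open>w r\<close> by at most the increment of
        \<open>Q\<close> up to a factor, while twice \<open>w r\<close> contributes nothing
        positive; the error is therefore quadratic.\<close>
      have "H y - H x = inner (w y - w x) (w x + w y)"
        by (simp add: H_def inner_diff_left inner_diff_right inner_add_right inner_commute)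
      also have "w y - w x = integral {x..y} q" using L1_derivative_diff[OF q xyT(1-3)] .
      also have "inner \<dots> (w x + w y) = integral {x..y} (\<lambda>r. inner (q r) (w x + w y))"
        using int by (simp add: integral_inner_const)
      also have "\<dots> = (LINT r:{x..y}|lebesgue. inner (q r) (w x + w y))"
        using i1 by (simp add: set_lebesgue_integral_eq_integral)
      also have "\<dots> \<le> (LINT r:{x..y}|lebesgue. norm (q r) * (2 * (Q y - Q x)))"
      proof (rule set_integral_mono_AE[OF i1 i2])
        show "AE r\<in>{x..y} in lebesgue. inner (q r) (w x + w y) \<le> norm (q r) * (2 * (Q y - Q x))"
          using AE_w
        proof eventually_elim
          case (elim r)
          show ?case
          proof
            assume r: "r \<in> {x..y}"
            with elim xyT have "inner (q r) (w r) \<le> 0" by auto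
            then have "inner (q r) (w x + w y) \<le> inner (q r) ((w x - w r) + (w y - w r))"
              by (simp add: inner_add_right inner_diff_right)
            also have "\<dots> \<le> norm (q r) * norm ((w x - w r) + (w y - w r))" by (rule norm_cauchy_schwarz)
            also have "norm ((w x - w r) + (w y - w r)) \<le> 2 * (Q y - Q x)"
              using norm_triangle_ineq[of "w x - w r" "w y - w r"] controlled_byD[OF wQ, of x r]
                controlled_byD[OF wQ, of r y] controlled_by_mono[OF wQ, of x y] r xyT
              by (simp add: norm_minus_commute)
            finally show "inner (q r) (w x + w y) \<le> norm (q r) * (2 * (Q y - Q x))"
              by (simp add: mult_left_mono)
          qed
        qed
      qed
      also have "\<dots> = integral {x..y} (\<lambda>r. norm (q r) * (2 * (Q y - Q x)))"
        using i2 by (simp add: set_lebesgue_integral_eq_integral del: set_integral_mult_left)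
      also have "\<dots> = (Q y - Q x) * (2 * (Q y - Q x))"
        using integral_Icc_diff[OF nq xyT(1-3)] by (simp add: Q_def)
      finally show "Q x \<le> Q y \<and> H y - H x \<le> 2 * (Q y - Q x)\<^sup>2"
        using controlled_by_mono[OF wQ, of x y] xyT by (simp add: power2_eq_square algebra_simps)
    qed (use t in auto)
    moreover have "w 0 = 0" using sol by (simp add: w_def sweeping_solution_def)
    ultimately have "inner (w t) (w t) \<le> 0" by (simp add: H_def)
    then show ?thesis by (metis inner_ge_zero inner_eq_zero_iff order_antisym)
  qed
  show ?thesis
  proof (rule extensionalityI)
    show "\<sigma>1 \<in> extensional {0..T}" "\<sigma>2 \<in> extensional {0..T}"
      using sol by (auto simp: sweeping_solution_def W11_in_def W11_def)
  qed (use w0 in \<open>simp add: w_def\<close>)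
qed

section \<open>The history operator as the unique solution\<close>

lemma history_op_eqI:
  "T > 0 \<Longrightarrow> sweeping_solution T C \<pi> \<sigma> \<Longrightarrow> history_op T C \<pi> = \<sigma>"
  unfolding history_op_def by (blast intro: the_equality sweeping_solution_unique)

text \<open>Existence and uniqueness make the \<open>THE\<close> denote the constructed solution;
  the variation bound is the control that comes with it.\<close>

lemma
  assumes "T > 0" "C \<noteq> {}" "closed C" "convex C" "\<pi> \<in> W11 T"
  shows history_op_W11_in: "history_op T C \<pi> \<in> W11_in T C"
    and variation_history_op_le: "variation (history_op T C \<pi>) 0 T \<le> variation \<pi> 0 T"
proof -
  obtain \<sigma> where \<sigma>: "sweeping_solution T C \<pi> \<sigma>" "controlled_by {0..T} \<sigma> (variation \<pi> 0)"
    using ex_sweeping_solution[OF assms] by blast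
  have "history_op T C \<pi> = \<sigma>" using history_op_eqI[OF assms(1) \<sigma>(1)] .
  then show "history_op T C \<pi> \<in> W11_in T C" "variation (history_op T C \<pi>) 0 T \<le> variation \<pi> 0 T"
    using \<sigma> variation_le[OF _ \<sigma>(2)] assms(1) by (auto simp: sweeping_solution_def)
qed

text \<open>The plastic part vanishes for an input with values in \<open>C\<close>, since 0 lies in
  every normal cone. This yields paths with explicitly known stress for the lower bound.\<close>

lemma history_op_id:
  assumes "T > 0" "closed C" "\<pi> \<in> W11_in T C"
  shows "history_op T C \<pi> = \<pi>"
proof (rule history_op_eqI[OF assms(1)])
  obtain p where "has_L1_derivative T \<pi> p" using assms(3) by (auto simp: W11_in_def W11_def)
  moreover have "closest_point C (\<pi> 0) = \<pi> 0"
    using assms by (intro closest_point_self) (auto simp: W11_in_def)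
  moreover have "AE t in lebesgue_on {0<..<T}. p t - p t \<in> normal_cone C (\<pi> t)"
    by (simp add: normal_cone_def)
  ultimately show "sweeping_solution T C \<pi> \<pi>"
    using assms(3) unfolding sweeping_solution_def by metis
qed

subsection \<open>Step functions and the decoder\<close>

lemma step_fun_apply:
  assumes t: "is_partition 0 T M t" and k: "k < M" "t k \<le> s" "s < t (Suc k)"
  shows "step_fun T M t v s = v k"
proof -
  have "0 \<le> s" "s < T"
    using is_partition_range[OF t, of k] is_partition_range[OF t, of "Suc k"] k by auto
  moreover have "(THE j. j < M \<and> t j \<le> s \<and> s < t (Suc j)) = k"
  proof (rule the_equality)
    fix j assume j: "j < M \<and> t j \<le> s \<and> s < t (Suc j)"
    show "j = k"
    proof (rule ccontr)
      assume "j \<noteq> k"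
      then consider "Suc j \<le> k" | "Suc k \<le> j" by linarith
      then show False
        by cases (use is_partition_mono[OF t, of "Suc j" k] is_partition_mono[OF t, of "Suc k" j] j k in auto)
    qed
  qed (use k in auto)
  ultimately show ?thesis by (simp add: step_fun_def)
qed

lemma step_fun_end: "0 \<le> T \<Longrightarrow> step_fun T M t v T = v M"
  by (simp add: step_fun_def)

lemma is_partition_cover:
  assumes t: "is_partition 0 T M t" and s: "0 \<le> s" "s < T"
  obtains k where "k < M" "t k \<le> s" "s < t (Suc k)"
proof -
  define j where "j = (LEAST j. s < t j)"
  have M: "s < t M" using s t by (simp add: is_partition_def)
  then have j: "s < t j" "j \<le> M" unfolding j_def by (rule LeastI, rule Least_le)
  have "j \<noteq> 0"
  proof
    assume "j = 0"
    with j(1) t s show False by (simp add: is_partition_def)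
  qed
  then obtain k where k: "j = Suc k" using not0_implies_Suc by blast
  have "\<not> s < t k" using not_less_Least[of k "\<lambda>j. s < t j"] k by (simp add: j_def)
  with k j show ?thesis by (intro that[of k]) auto
qed

lemma step_fun_at_partition:
  assumes t: "is_partition 0 T M t" and "0 \<le> T" "k \<le> M"
  shows "step_fun T M t v (t k) = v k"
proof (cases "k = M")
  case True
  then show ?thesis using t step_fun_end[OF \<open>0 \<le> T\<close>] by (simp add: is_partition_def)
next
  case False
  then show ?thesis using assms by (intro step_fun_apply[OF t]) (auto simp: is_partition_def)
qed

lemma step_fun_cong:
  assumes t: "is_partition 0 T M t" and "\<And>k. k \<le> M \<Longrightarrow> v k = v' k"
  shows "step_fun T M t v = step_fun T M t v'"
proof
  fix s
  consider "s \<notin> {0..T}" | "s = T" "s \<in> {0..T}" | "0 \<le> s" "s < T" by fastforce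
  then show "step_fun T M t v s = step_fun T M t v' s"
  proof cases
    case 3
    then obtain k where "k < M" "t k \<le> s" "s < t (Suc k)" by (rule is_partition_cover[OF t])
    then show ?thesis using assms(2)[of k] by (simp add: step_fun_apply[OF t])
  qed (use assms(2)[of M] in \<open>auto simp: step_fun_def\<close>)
qed

lemma step_fun_measurable:
  fixes v :: "nat \<Rightarrow> 'a::euclidean_space"
  assumes t: "is_partition 0 T M t" and T: "0 < T"
  shows "step_fun T M t v \<in> borel_measurable (lebesgue_on {0..T})"
proof -
  let ?g = "\<lambda>s. (\<Sum>k<M. indicator {t k..<t (Suc k)} s *\<^sub>R v k) + indicator {T} s *\<^sub>R v M"
  have "?g \<in> borel_measurable borel" by measurable
  then have "?g \<in> borel_measurable (lebesgue_on {0..T})"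
    by (intro measurable_restrict_space1 measurable_completion) simp
  moreover have "step_fun T M t v s = ?g s" if "s \<in> {0..T}" for s
  proof (cases "s = T")
    case True
    have "indicator {t k..<t (Suc k)} s = (0 :: real)" if "k < M" for k
      using is_partition_range[OF t, of "Suc k"] that True by auto
    then show ?thesis using True T by (simp add: step_fun_end)
  next
    case False
    with \<open>s \<in> {0..T}\<close> have "0 \<le> s" "s < T" by auto
    then obtain k where k: "k < M" "t k \<le> s" "s < t (Suc k)" by (rule is_partition_cover[OF t])
    have "indicator {t j..<t (Suc j)} s = (if j = k then 1 else 0 :: real)" if "j < M" for j
    proof -
      consider "j = k" | "Suc j \<le> k" | "Suc k \<le> j" by linarith
      then show ?thesis
        by cases (use is_partition_mono[OF t, of "Suc j" k] is_partition_mono[OF t, of "Suc k" j] that k in auto)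
    qed
    then have "(\<Sum>j<M. indicator {t j..<t (Suc j)} s *\<^sub>R v j) = (\<Sum>j<M. if j = k then v j else 0)"
      by (intro sum.cong) auto
    also have "\<dots> = v k" using k by simp
    finally show ?thesis using False by (simp add: step_fun_apply[OF t k])
  qed
  ultimately show ?thesis by (subst measurable_cong[of _ _ ?g]) auto
qed

text \<open>The representation is picked by \<open>SOME\<close>; both error bounds are therefore
  proved for an arbitrary representation with at most \<open>N\<close> pieces.\<close>

lemma decoder_step_fun:
  assumes "z \<in> step_functions T N"
  obtains M t v where "represents T N z M t v" "decoder T C N z = step_fun T M t (decoder_values C v)"
proof -
  let ?P = "\<lambda>(M, t, v). represents T N z M t v"
  obtain M t v where eq: "(SOME x. ?P x) = (M, t, v)" by (cases "SOME x. ?P x")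
  have "\<exists>x. ?P x" using assms by (simp add: step_functions_def)
  then have "?P (SOME x. ?P x)" by (rule someI_ex)
  then have "represents T N z M t v" unfolding eq by simp
  moreover have "decoder T C N z = step_fun T M t (decoder_values C v)"
    unfolding decoder_def eq by simp
  ultimately show ?thesis by (rule that)
qed

text \<open>When the values lie in \<open>C\<close> the recursion telescopes: the point projected at
  step \<open>Suc k\<close> is \<open>v (Suc k)\<close> itself. Any representation has its values in
  \<open>C\<close>, because \<open>z\<close> attains \<open>v k\<close> at the partition point
  \<open>t k\<close>.\<close>

lemma decoder_id:
  assumes "0 \<le> T" "closed C" "z \<in> step_functions T N" "\<And>s. s \<in> {0..T} \<Longrightarrow> z s \<in> C"
  shows "decoder T C N z = z"
proof -
  obtain M t v where rep: "represents T N z M t v" and dec: "decoder T C N z = step_fun T M t (decoder_values C v)"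
    using assms(3) by (rule decoder_step_fun)
  have t: "is_partition 0 T M t" and z: "z = step_fun T M t v" using rep by (auto simp: represents_def)
  have vC: "v k \<in> C" if "k \<le> M" for k
    using assms(4)[OF is_partition_range[OF t that]] step_fun_at_partition[OF t assms(1) that, of v]
    by (metis z)
  have "decoder_values C v k = v k" if "k \<le> M" for k
    using that by (induction k) (auto simp: closest_point_self vC)
  then have "step_fun T M t (decoder_values C v) = step_fun T M t v" by (intro step_fun_cong[OF t])
  with dec z show ?thesis by metis
qed

subsection \<open>Sampled equal-variation approximation\<close>

text \<open>Isolates the paths of positive variation, for which the levels are distinct and the
  level times form a partition; constant paths are treated outside the locale.\<close>

locale equal_variation =
  fixes T :: real and N :: nat and \<sigma> :: "real \<Rightarrow> 'a::euclidean_space"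
  assumes T: "0 < T" and N: "1 \<le> N" and \<sigma>: "\<sigma> \<in> W11 T" and V: "0 < variation \<sigma> 0 T"
begin

lemma variation_mono: "x \<in> {0..T} \<Longrightarrow> y \<in> {0..T} \<Longrightarrow> x \<le> y \<Longrightarrow> variation \<sigma> 0 x \<le> variation \<sigma> 0 y"
  by (rule controlled_by_mono[OF W11_controlled_by_variation[OF \<sigma>]])

lemma level_time:
  assumes "k \<le> N"
  shows "level_time T N \<sigma> k \<in> {0..T}"
    and "variation \<sigma> 0 (level_time T N \<sigma> k) = real k * variation \<sigma> 0 T / real N"
proof -
  let ?c = "real k * variation \<sigma> 0 T / real N"
  have "level_time T N \<sigma> k \<in> {0..T} \<and> variation \<sigma> 0 (level_time T N \<sigma> k) = ?c"
  proof (cases "k < N")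
    case True
    let ?S = "{t \<in> {0..T}. variation \<sigma> 0 t = ?c}"
    have "?c \<le> variation \<sigma> 0 T"
      using True V N by (simp add: divide_le_eq mult.commute)
    then obtain t where "0 \<le> t" "t \<le> T" "variation \<sigma> 0 t = ?c"
      using IVT'[of "variation \<sigma> 0" 0 ?c T] variation_continuous_on[OF \<sigma>] T V by auto
    then have "?S \<noteq> {}" by auto
    \<comment> \<open>A \<open>LEAST\<close> over the reals is a minimum only if one is attained;
      compactness of the level set ensures this.\<close>
    moreover have "compact ?S"
    proof -
      have "?S = {0..T} \<inter> variation \<sigma> 0 -` {?c}" by auto
      then have "closed ?S"
        using continuous_closed_preimage[OF variation_continuous_on[OF \<sigma>], of "{?c}"] by simp
      moreover have "bounded ?S" by (rule bounded_subset[of "{0..T}"]) auto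
      ultimately show ?thesis by (simp add: compact_eq_bounded_closed)
    qed
    ultimately obtain m where m: "m \<in> ?S" "\<And>t. t \<in> ?S \<Longrightarrow> m \<le> t"
      using compact_attains_inf[of ?S] by blast
    then have "(LEAST t. t \<in> {0..T} \<and> variation \<sigma> 0 t = ?c) = m"
      by (intro Least_equality) auto
    with m True show ?thesis by (simp add: level_time_def)
  next
    case False
    with assms T N show ?thesis by (simp add: level_time_def)
  qed
  then show "level_time T N \<sigma> k \<in> {0..T}"
    "variation \<sigma> 0 (level_time T N \<sigma> k) = real k * variation \<sigma> 0 T / real N" by auto
qed

lemma level_time_0: "level_time T N \<sigma> 0 = 0"
proof -
  have "(LEAST t. t \<in> {0..T} \<and> variation \<sigma> 0 t = 0) = 0"
    using T by (intro Least_equality) auto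
  with N show ?thesis by (simp add: level_time_def)
qed

lemma level_time_less: "k < N \<Longrightarrow> level_time T N \<sigma> k < level_time T N \<sigma> (Suc k)"
proof (rule ccontr)
  assume k: "k < N" and "\<not> level_time T N \<sigma> k < level_time T N \<sigma> (Suc k)"
  then have "variation \<sigma> 0 (level_time T N \<sigma> (Suc k)) \<le> variation \<sigma> 0 (level_time T N \<sigma> k)"
    using level_time[of k] level_time[of "Suc k"] by (intro variation_mono) auto
  then show False
    using level_time(2)[of k] level_time(2)[of "Suc k"] k V N by (simp add: divide_le_cancel)
qed

lemma is_partition_level_time: "is_partition 0 T N (level_time T N \<sigma>)"
  using level_time_0 level_time_less by (simp add: is_partition_def) (simp add: level_time_def)

text \<open>The required level lies V/(2N) above that of the left end of the piece and V/(2N) below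
  that of the right end, so the intermediate value theorem applies.\<close>

lemma ex_admissible_times: "\<exists>\<tau>. admissible_times T N \<sigma> \<tau>"
proof -
  let ?L = "level_time T N \<sigma>"
  have "\<exists>\<tau>\<in>{?L (k - 1)..?L k}. variation \<sigma> 0 \<tau> = (2 * real k - 1) * variation \<sigma> 0 T / (2 * real N)"
    if k: "k \<in> {1..N}" for k
  proof -
    let ?c = "(2 * real k - 1) * variation \<sigma> 0 T / (2 * real N)"
    have "?L (k - 1) \<le> ?L k" using level_time_less[of "k - 1"] k by (cases k) auto
    moreover have "variation \<sigma> 0 (?L (k - 1)) \<le> ?c" "?c \<le> variation \<sigma> 0 (?L k)"
    proof -
      have "?c = (real k - 1) * variation \<sigma> 0 T / real N + variation \<sigma> 0 T / (2 * real N)"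
        "real k * variation \<sigma> 0 T / real N = ?c + variation \<sigma> 0 T / (2 * real N)"
        using N by (simp_all add: field_simps)
      moreover have "0 \<le> variation \<sigma> 0 T / (2 * real N)" using V by simp
      moreover have "variation \<sigma> 0 (?L (k - 1)) = (real k - 1) * variation \<sigma> 0 T / real N"
        "variation \<sigma> 0 (?L k) = real k * variation \<sigma> 0 T / real N"
        using level_time(2)[of "k - 1"] level_time(2)[of k] k by (auto simp: of_nat_diff)
      ultimately show "variation \<sigma> 0 (?L (k - 1)) \<le> ?c" "?c \<le> variation \<sigma> 0 (?L k)" by linarith+
    qed
    moreover have "continuous_on {?L (k - 1)..?L k} (variation \<sigma> 0)"
      using level_time(1)[of "k - 1"] level_time(1)[of k] k
      by (intro continuous_on_subset[OF variation_continuous_on[OF \<sigma>]]) auto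
    ultimately show ?thesis using IVT'[of "variation \<sigma> 0" "?L (k - 1)" ?c "?L k"] by auto
  qed
  then show ?thesis unfolding admissible_times_def by metis
qed

text \<open>On a piece the variation runs through an interval of length V/N, and the sample sits at
  its midpoint. The witness \<open>r\<close> records that the approximation takes only values of
  \<open>\<sigma>\<close>, which places it in \<open>C\<close> when \<open>\<sigma>\<close> is
  \<open>C\<close>-valued.\<close>

lemma sampled_approx_bound:
  assumes \<tau>: "admissible_times T N \<sigma> \<tau>" and t: "t \<in> {0..T}"
  shows "\<exists>r\<in>{0..T}. sampled_approx T N \<tau> \<sigma> t = \<sigma> r \<and>
    norm (\<sigma> t - \<sigma> r) \<le> variation \<sigma> 0 T / (2 * real N)"
proof -
  let ?L = "level_time T N \<sigma>" and ?V = "variation \<sigma> 0 T"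
  have S: "sampled_approx T N \<tau> \<sigma> = step_fun T N ?L (\<lambda>k. if k < N then \<sigma> (\<tau> (Suc k)) else \<sigma> T)"
    using V by (simp add: sampled_approx_def)
  show ?thesis
  proof (cases "t = T")
    case True
    then show ?thesis using T V by (intro bexI[of _ T]) (auto simp: S step_fun_end)
  next
    case False
    with t have "0 \<le> t" "t < T" by auto
    then obtain k where k: "k < N" "?L k \<le> t" "t < ?L (Suc k)"
      by (rule is_partition_cover[OF is_partition_level_time])
    let ?r = "\<tau> (Suc k)"
    have r: "?r \<in> {?L k..?L (Suc k)}"
      and ar: "variation \<sigma> 0 ?r = (2 * real (Suc k) - 1) * ?V / (2 * real N)"
      using \<tau>[unfolded admissible_times_def, rule_format, of "Suc k"] k(1) by auto
    have rT: "?r \<in> {0..T}" using r level_time(1)[of k] level_time(1)[of "Suc k"] k by auto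
    have "variation \<sigma> 0 (?L k) \<le> variation \<sigma> 0 t" "variation \<sigma> 0 t \<le> variation \<sigma> 0 (?L (Suc k))"
      using k t level_time(1)[of k] level_time(1)[of "Suc k"] by (auto intro!: variation_mono)
    then have at: "real k * ?V / real N \<le> variation \<sigma> 0 t" "variation \<sigma> 0 t \<le> real (Suc k) * ?V / real N"
      using level_time(2)[of k] level_time(2)[of "Suc k"] k by auto
    have "norm (\<sigma> t - \<sigma> ?r) \<le> \<bar>variation \<sigma> 0 t - variation \<sigma> 0 ?r\<bar>"
      using controlled_byD[OF W11_controlled_by_variation[OF \<sigma>], of t ?r]
        controlled_byD[OF W11_controlled_by_variation[OF \<sigma>], of ?r t] t rT
      by (cases "t \<le> ?r") (auto simp: norm_minus_commute)
    also have "\<dots> \<le> ?V / (2 * real N)"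
    proof -
      have "variation \<sigma> 0 ?r = real k * ?V / real N + ?V / (2 * real N)"
        "real (Suc k) * ?V / real N = real k * ?V / real N + 2 * (?V / (2 * real N))"
        using N unfolding ar by (simp_all add: field_simps)
      with at show ?thesis by simp
    qed
    finally show ?thesis
      using rT k(1) by (intro bexI[of _ ?r]) (auto simp: S step_fun_apply[OF is_partition_level_time k])
  qed
qed

lemma sampled_approx_in_step_functions: "sampled_approx T N \<tau> \<sigma> \<in> step_functions T N"
  using V is_partition_level_time
  by (auto simp: sampled_approx_def step_functions_def represents_def)

end

lemma ex_sampling_rule:
  assumes "0 < T" "1 \<le> N"
  shows "\<exists>\<tau>. sampling_rule T C N \<tau>"
proof -
  have "\<exists>\<tau>. admissible_times T N \<sigma> \<tau>" if "\<sigma> \<in> W11_in T C" "variation \<sigma> 0 T > 0" for \<sigma>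
  proof -
    interpret equal_variation T N \<sigma>
      using that assms by unfold_locales (auto simp: W11_in_def)
    show ?thesis by (rule ex_admissible_times)
  qed
  then show ?thesis unfolding sampling_rule_def by metis
qed

lemma sampled_approx:
  assumes T: "0 < T" and N: "1 \<le> N" and \<tau>: "sampling_rule T C N \<tau>" and \<sigma>: "\<sigma> \<in> W11_in T C"
  shows "sampled_approx T N (\<tau> \<sigma>) \<sigma> \<in> step_functions T N"
    and "t \<in> {0..T} \<Longrightarrow> sampled_approx T N (\<tau> \<sigma>) \<sigma> t \<in> C"
    and "t \<in> {0..T} \<Longrightarrow> norm (\<sigma> t - sampled_approx T N (\<tau> \<sigma>) \<sigma> t) \<le> variation \<sigma> 0 T / (2 * real N)"
proof -
  have W: "\<sigma> \<in> W11 T" and inC: "\<And>t. t \<in> {0..T} \<Longrightarrow> \<sigma> t \<in> C" using \<sigma> by (auto simp: W11_in_def)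
  note ctrl = W11_controlled_by_variation[OF W]
  have "variation \<sigma> 0 T \<ge> 0" using controlled_by_mono[OF ctrl, of 0 T] T by simp
  then consider "variation \<sigma> 0 T = 0" | "variation \<sigma> 0 T > 0" by linarith
  then have "sampled_approx T N (\<tau> \<sigma>) \<sigma> \<in> step_functions T N \<and> (\<forall>t\<in>{0..T}. \<exists>r\<in>{0..T}.
    sampled_approx T N (\<tau> \<sigma>) \<sigma> t = \<sigma> r \<and> norm (\<sigma> t - \<sigma> r) \<le> variation \<sigma> 0 T / (2 * real N))"
  proof cases
    case 1
    \<comment> \<open>A constant is represented by one piece, which fits because \<open>N\<close> is
      at least 1.\<close>
    let ?t = "\<lambda>j::nat. if j = 0 then 0 else T"
    have "represents T N (restrict (\<lambda>t. \<sigma> 0) {0..T}) 1 ?t (\<lambda>_. \<sigma> 0)"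
      using T N by (auto simp: represents_def is_partition_def step_fun_def)
    then have "sampled_approx T N (\<tau> \<sigma>) \<sigma> \<in> step_functions T N"
      using 1 by (auto simp: sampled_approx_def step_functions_def)
    moreover have "sampled_approx T N (\<tau> \<sigma>) \<sigma> t = \<sigma> t" if "t \<in> {0..T}" for t
    proof -
      have "norm (\<sigma> t - \<sigma> 0) \<le> variation \<sigma> 0 t - variation \<sigma> 0 0"
        using that T by (intro controlled_byD[OF ctrl]) auto
      moreover have "variation \<sigma> 0 t \<le> variation \<sigma> 0 T"
        using that T by (intro controlled_by_mono[OF ctrl]) auto
      ultimately have "norm (\<sigma> t - \<sigma> 0) \<le> 0"
        using 1 variation_self[of \<sigma> 0] by linarith
      then have "\<sigma> 0 = \<sigma> t" by simp
      moreover have "sampled_approx T N (\<tau> \<sigma>) \<sigma> t = \<sigma> 0"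
        using that 1 by (simp add: sampled_approx_def)
      ultimately show ?thesis by (rule trans[rotated])
    qed
    ultimately show ?thesis using 1 by (auto intro!: bexI)
  next
    case 2
    have adm: "admissible_times T N \<sigma> (\<tau> \<sigma>)" using \<tau> \<sigma> 2 by (auto simp: sampling_rule_def)
    interpret equal_variation T N \<sigma> using T N W 2 by unfold_locales
    show ?thesis using sampled_approx_bound[OF adm] sampled_approx_in_step_functions by blast
  qed
  then show "sampled_approx T N (\<tau> \<sigma>) \<sigma> \<in> step_functions T N"
    "t \<in> {0..T} \<Longrightarrow> sampled_approx T N (\<tau> \<sigma>) \<sigma> t \<in> C"
    "t \<in> {0..T} \<Longrightarrow> norm (\<sigma> t - sampled_approx T N (\<tau> \<sigma>) \<sigma> t) \<le> variation \<sigma> 0 T / (2 * real N)"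
    using inC by metis+
qed

text \<open>The denominator in \<open>worst_error\<close> has to be positive for the
  \<open>ereal\<close> quotient to respect the order and to cancel.\<close>

lemma norm_BV0_pos:
  assumes T: "0 < T" and \<pi>: "\<pi> \<in> W11 T - {zero_fun T}"
  shows "0 < norm_BV0 T \<pi>"
proof -
  have ctrl: "controlled_by {0..T} \<pi> (variation \<pi> 0)" using \<pi> by (auto intro: W11_controlled_by_variation)
  have "\<exists>t\<in>{0..T}. \<pi> t \<noteq> 0"
  proof (rule ccontr)
    assume "\<not> ?thesis"
    then have "\<pi> = zero_fun T"
      using \<pi> by (intro extensionalityI[of _ "{0..T}"]) (auto simp: W11_def zero_fun_def)
    with \<pi> show False by simp
  qed
  then obtain t where t: "t \<in> {0..T}" "\<pi> t \<noteq> 0" by blast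
  have "0 < norm (\<pi> t)" using t by simp
  also have "\<dots> \<le> norm (\<pi> 0) + norm (\<pi> t - \<pi> 0)" using norm_triangle_ineq[of "\<pi> 0" "\<pi> t - \<pi> 0"] by simp
  also have "norm (\<pi> t - \<pi> 0) \<le> variation \<pi> 0 T"
    using controlled_byD[OF ctrl, of 0 t] controlled_by_mono[OF ctrl, of t T] t T by simp
  finally show ?thesis by (simp add: norm_BV0_def)
qed

subsection \<open>The lower bound\<close>

text \<open>Turns an almost-everywhere bound into actual points as close as desired to the ends of a
  piece.\<close>

lemma AE_lebesgue_ex_interval:
  assumes "AE x in lebesgue. P x" "a < (b::real)"
  obtains x where "x \<in> {a<..<b}" "P x"
proof -
  have "\<exists>x\<in>{a<..<b}. P x"
  proof (rule ccontr)
    assume "\<not> ?thesis"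
    with assms(1) have "AE x in lebesgue. x \<notin> {a<..<b}" by (auto elim: eventually_mono)
    then have "{a<..<b} \<in> null_sets lebesgue" by (subst AE_iff_null_sets) auto
    with assms(2) show False by (simp add: null_sets_def)
  qed
  with that show ?thesis by blast
qed

lemma is_partition_long_interval:
  assumes t: "is_partition 0 T M t" and "0 < T" "M \<le> N"
  obtains k where "k < M" "T / real N \<le> t (Suc k) - t k"
proof -
  have "\<exists>k<M. T / real N \<le> t (Suc k) - t k"
  proof (rule ccontr)
    assume "\<not> ?thesis"
    then have *: "\<And>k. k < M \<Longrightarrow> t (Suc k) - t k < T / real N" by auto
    have tT: "t M - t 0 = T" using t by (simp add: is_partition_def)
    \<comment> \<open>The strict comparison of sums needs a nonempty index set.\<close>
    have "M \<noteq> 0" using tT assms(2) by (intro notI) simp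
    have "T = (\<Sum>k<M. t (Suc k) - t k)" using tT by (simp add: sum_lessThan_telescope)
    also have "\<dots> < (\<Sum>k<M. T / real N)"
      using * \<open>M \<noteq> 0\<close> by (intro sum_strict_mono) auto
    also have "\<dots> = real M * (T / real N)" by simp
    also have "\<dots> \<le> real N * (T / real N)" using assms by (intro mult_right_mono) auto
    also have "\<dots> \<le> T" using assms by simp
    finally show False by simp
  qed
  with that show ?thesis by blast
qed

text \<open>Along a piece of length at least \<open>T / real N\<close> the path travels at least
  \<open>norm e / real N\<close> while the step function stands still. The essential supremum does
  not see the ends themselves, so points within \<open>\<delta>\<close> of them are used, and the
  loss is paid from the strict gap below the claimed bound.\<close>

lemma norm_Linf_linear_minus_step_fun:
  fixes e :: "'a::euclidean_space"
  assumes t: "is_partition 0 T M t" and T: "0 < T" and M: "M \<le> N"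
  shows "ereal (norm e / (2 * real N)) \<le> norm_Linf T (\<lambda>s. restrict (\<lambda>s. (s / T) *\<^sub>R e) {0..T} s - step_fun T M t v s)"
    (is "_ \<le> norm_Linf T ?u")
proof (rule ccontr)
  obtain k where k: "k < M" "T / real N \<le> t (Suc k) - t k"
    using is_partition_long_interval[OF t T M] .
  assume "\<not> ?thesis"
  then have "norm_Linf T ?u < ereal (norm e / (2 * real N))" by (simp add: not_le)
  then obtain c where c: "norm_Linf T ?u < ereal c" "c < norm e / (2 * real N)"
    using ereal_dense2 by fastforce
  let ?a = "t k" and ?b = "t (Suc k)"
  have ab: "0 \<le> ?a" "?a < ?b" "?b \<le> T"
    using is_partition_range[OF t, of k] is_partition_range[OF t, of "Suc k"] t k by (auto simp: is_partition_def)
  have "AE s in lebesgue_on {0..T}. ereal (norm (?u s)) \<le> norm_Linf T ?u"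
    unfolding norm_Linf_def by (rule esssup_AE)
  then have AE: "AE s in lebesgue. s \<in> {0..T} \<longrightarrow> norm (?u s) \<le> c"
    using AE_lebesgue_on_iff[of "{0..T}"] c(1)
    by simp (auto elim!: eventually_mono dest: le_less_trans)
  \<comment> \<open>For \<open>e = 0\<close> the number \<open>c\<close> would be negative;
    excluding this makes \<open>norm e\<close> positive and \<open>\<delta>\<close> well
    defined.\<close>
  have "0 \<le> c"
  proof -
    obtain s where "s \<in> {0<..<T}" "s \<in> {0..T} \<longrightarrow> norm (?u s) \<le> c"
      using AE_lebesgue_ex_interval[OF AE T] .
    then have "norm (?u s) \<le> c" by simp
    with norm_ge_zero[of "?u s"] show ?thesis by (rule order_trans)
  qed
  have N: "0 < real N" using k(1) M by simp
  have e: "0 < norm e"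
    using c(2) \<open>0 \<le> c\<close> N by (cases "e = 0") auto
  define \<eta> where "\<eta> = norm e / real N - 2 * c"
  have \<eta>: "0 < \<eta>" using c(2) by (simp add: \<eta>_def field_simps)
  \<comment> \<open>Moving inwards at both ends costs \<open>2 * \<delta> * norm e / T\<close>,
    which the second bound keeps at most half of the slack \<open>\<eta>\<close>; the first bound
    keeps \<open>x\<close> to the left of \<open>y\<close>.\<close>
  define \<delta> where "\<delta> = min ((?b - ?a) / 4) (\<eta> * T / (4 * norm e))"
  have \<delta>: "0 < \<delta>" using ab \<eta> T e by (simp add: \<delta>_def)
  have \<delta>_le: "\<delta> \<le> (?b - ?a) / 4" "\<delta> \<le> \<eta> * T / (4 * norm e)"
    unfolding \<delta>_def by (rule min.cobounded1, rule min.cobounded2)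
  obtain x where x: "x \<in> {?a<..<?a + \<delta>}" "x \<in> {0..T} \<longrightarrow> norm (?u x) \<le> c"
    using AE_lebesgue_ex_interval[OF AE, of ?a "?a + \<delta>"] \<delta> by auto
  obtain y where y: "y \<in> {?b - \<delta><..<?b}" "y \<in> {0..T} \<longrightarrow> norm (?u y) \<le> c"
    using AE_lebesgue_ex_interval[OF AE, of "?b - \<delta>" ?b] \<delta> by auto
  have xy: "x \<in> {0..T}" "y \<in> {0..T}" "x \<in> {?a..<?b}" "y \<in> {?a..<?b}" "?b - ?a - 2 * \<delta> \<le> y - x" "x \<le> y"
    using x(1) y(1) ab \<delta>_le by auto
  have uxy: "?u y - ?u x = ((y - x) / T) *\<^sub>R e"
    using xy step_fun_apply[OF t k(1), of x v] step_fun_apply[OF t k(1), of y v]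
    by (simp add: diff_divide_distrib scaleR_diff_left)
  have "(T / real N - 2 * \<delta>) / T * norm e \<le> (y - x) / T * norm e"
    using xy(5) k(2) T by (intro mult_right_mono divide_right_mono) auto
  also have "\<dots> = norm (?u y - ?u x)" using xy(6) T unfolding uxy by simp
  also have "\<dots> \<le> norm (?u y) + norm (?u x)" by (rule norm_triangle_ineq4)
  also have "\<dots> \<le> 2 * c" using x(2) y(2) xy by simp
  finally have "(T / real N - 2 * \<delta>) / T * norm e \<le> 2 * c" .
  moreover have "(T / real N - 2 * \<delta>) / T * norm e = norm e / real N - 2 * \<delta> * norm e / T"
    using T by (simp add: field_simps)
  moreover have "2 * \<delta> * norm e / T \<le> \<eta> / 2"
    using \<delta>_le(2) T e by (simp add: field_simps)
  ultimately show False using \<eta> by (simp add: \<eta>_def)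
qed

text \<open>The test path runs at constant speed from 0 to a boundary point of a ball contained in
  \<open>C\<close>. It is its own stress, and since it starts at 0 its BV norm is exactly the
  distance \<open>r\<close> travelled, so the quotient loses nothing.\<close>

lemma worst_error_ge:
  fixes C :: "'a::euclidean_space set"
  assumes T: "0 < T" and C: "closed C" "0 \<in> interior C" and f: "f \<in> encoders T N"
  shows "ereal (1 / (2 * real N)) \<le> worst_error T C N f"
proof -
  obtain r where r: "0 < r" "cball 0 r \<subseteq> C" using C(2) mem_interior_cball by blast
  \<comment> \<open>The type class forces dimension at least 1, so a direction for the path
    exists.\<close>
  obtain b :: 'a where b: "b \<in> Basis" using nonempty_Basis by blast
  define e where "e = r *\<^sub>R b"
  have e: "norm e = r" using b r by (simp add: e_def)
  define \<pi> where "\<pi> = restrict (\<lambda>s. (s / T) *\<^sub>R e) {0..T}"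
  have \<pi>_eq: "\<pi> s = (s / T) *\<^sub>R e" if "s \<in> {0..T}" for s using that by (simp add: \<pi>_def)
  have "has_L1_derivative T \<pi> (\<lambda>_. (1 / T) *\<^sub>R e)"
    by (rule L1_derivativeI) (auto simp: \<pi>_eq)
  then have W: "\<pi> \<in> W11 T" by (auto simp: W11_def \<pi>_def)
  have "\<pi> s \<in> C" if s: "s \<in> {0..T}" for s
  proof -
    have "norm (\<pi> s) = (s / T) * r" using s T e by (simp add: \<pi>_eq)
    also have "\<dots> \<le> 1 * r" using s T r by (intro mult_right_mono) auto
    finally show ?thesis using r(2) by auto
  qed
  with W have hist: "history_op T C \<pi> = \<pi>" using T C(1) by (intro history_op_id) (auto simp: W11_in_def)
  have ctrl: "controlled_by {0..T} \<pi> (\<lambda>s. (s / T) * r)"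
    unfolding controlled_by_def
  proof (intro ballI impI)
    fix x y assume xy: "x \<in> {0..T}" "y \<in> {0..T}" "x \<le> y"
    then have "\<pi> y - \<pi> x = ((y - x) / T) *\<^sub>R e"
      by (simp add: \<pi>_eq diff_divide_distrib scaleR_diff_left)
    then have "norm (\<pi> y - \<pi> x) = (y - x) / T * r" using xy T e by simp
    then show "norm (\<pi> y - \<pi> x) \<le> y / T * r - x / T * r" by (simp add: diff_divide_distrib left_diff_distrib)
  qed
  have "\<pi> T = e" "\<pi> 0 = 0" using T by (simp_all add: \<pi>_eq)
  moreover have "variation \<pi> 0 T \<le> r" using variation_le[OF _ ctrl] T by simp
  ultimately have BV: "norm_BV0 T \<pi> = r"
    using controlled_byD[OF controlled_by_variation[OF ctrl], of 0 T] T e by (simp add: norm_BV0_def)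
  have "\<pi> \<noteq> zero_fun T" using \<open>\<pi> T = e\<close> e r T by (auto simp: zero_fun_def)
  with W have \<pi>_mem: "\<pi> \<in> W11 T - {zero_fun T}" by simp
  have "f \<pi> \<in> step_functions T N" using f W by (auto simp: encoders_def)
  then obtain M t v where rep: "represents T N (f \<pi>) M t v"
    and dec: "decoder T C N (f \<pi>) = step_fun T M t (decoder_values C v)"
    by (rule decoder_step_fun)
  have "ereal (r / (2 * real N)) \<le> recon_error T C N f \<pi>"
    using norm_Linf_linear_minus_step_fun[of T M t N e "decoder_values C v"] rep T e
    unfolding recon_error_def hist dec represents_def by (simp add: \<pi>_def)
  then have "ereal (r / (2 * real N)) / ereal r \<le> recon_error T C N f \<pi> / ereal (norm_BV0 T \<pi>)"
    unfolding BV using r by (intro ereal_divide_right_mono) auto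
  also have "\<dots> \<le> worst_error T C N f"
    unfolding worst_error_def using \<pi>_mem by (rule SUP_upper)
  finally show ?thesis using r by simp
qed

subsection \<open>The upper bound\<close>

lemma
  fixes C :: "'a::euclidean_space set"
  assumes T: "0 < T" and C: "C \<noteq> {}" "closed C" "convex C" and N: "1 \<le> N"
    and \<tau>: "sampling_rule T C N \<tau>"
  shows stress_encoder_in_encoders: "stress_encoder T C N \<tau> \<in> encoders T N"
    and recon_error_stress_encoder: "\<pi> \<in> W11 T \<Longrightarrow>
      recon_error T C N (stress_encoder T C N \<tau>) \<pi> \<le> ereal (1 / (2 * real N) * norm_BV0 T \<pi>)"
proof -
  show "stress_encoder T C N \<tau> \<in> encoders T N"
    using history_op_W11_in[OF T C] sampled_approx(1)[OF T N \<tau>]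
    by (auto simp: encoders_def stress_encoder_def)
  assume \<pi>: "\<pi> \<in> W11 T"
  define \<sigma> where "\<sigma> = history_op T C \<pi>"
  have \<sigma>: "\<sigma> \<in> W11_in T C" and var: "variation \<sigma> 0 T \<le> variation \<pi> 0 T"
    using history_op_W11_in[OF T C \<pi>] variation_history_op_le[OF T C \<pi>] by (auto simp: \<sigma>_def)
  define S where "S = sampled_approx T N (\<tau> \<sigma>) \<sigma>"
  have S: "S \<in> step_functions T N" "\<And>t. t \<in> {0..T} \<Longrightarrow> S t \<in> C"
    "\<And>t. t \<in> {0..T} \<Longrightarrow> norm (\<sigma> t - S t) \<le> variation \<sigma> 0 T / (2 * real N)"
    unfolding S_def using sampled_approx[OF T N \<tau> \<sigma>] by auto
  have dec: "decoder T C N (stress_encoder T C N \<tau> \<pi>) = S"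
    using decoder_id[OF _ C(2) S(1,2)] T by (simp add: stress_encoder_def S_def \<sigma>_def)
  obtain s where "has_L1_derivative T \<sigma> s" using \<sigma> by (auto simp: W11_in_def W11_def)
  then have "\<sigma> \<in> borel_measurable (lebesgue_on {0..T})"
    by (intro continuous_imp_measurable_on_sets_lebesgue has_L1_derivative_continuous_on) auto
  moreover have "S \<in> borel_measurable (lebesgue_on {0..T})"
    using S(1) step_fun_measurable[OF _ T] by (auto simp: step_functions_def represents_def)
  ultimately have meas: "(\<lambda>t. ereal (norm (\<sigma> t - S t))) \<in> borel_measurable (lebesgue_on {0..T})"
    by measurable
  have "AE t in lebesgue_on {0..T}. ereal (norm (\<sigma> t - S t)) \<le> ereal (1 / (2 * real N) * norm_BV0 T \<pi>)"
  proof (rule AE_I2)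
    fix t assume "t \<in> space (lebesgue_on {0..T})"
    then have "norm (\<sigma> t - S t) \<le> variation \<sigma> 0 T / (2 * real N)" using S(3) by simp
    also have "\<dots> \<le> norm_BV0 T \<pi> / (2 * real N)"
      using var by (intro divide_right_mono) (auto simp: norm_BV0_def intro: add_increasing)
    finally show "ereal (norm (\<sigma> t - S t)) \<le> ereal (1 / (2 * real N) * norm_BV0 T \<pi>)" by simp
  qed
  then show "recon_error T C N (stress_encoder T C N \<tau>) \<pi> \<le> ereal (1 / (2 * real N) * norm_BV0 T \<pi>)"
    unfolding recon_error_def norm_Linf_def dec \<sigma>_def[symmetric] by (rule esssup_I[OF meas])
qed

text \<open>The sampling times are left open, so attainment is claimed for every sampling rule; the
  existence of a rule keeps this claim from being vacuous.\<close>

theorem theorem3p6: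
  fixes C :: "'a::euclidean_space set" and T :: real and N :: nat
  assumes "T > 0" and "C \<noteq> {}" and "closed C" and "convex C" and "0 \<in> interior C"
    and "N \<ge> 1"
  shows "minimax_error T C N = ereal (1 / (2 * real N)) \<and>
    (\<exists>\<tau>. sampling_rule T C N \<tau>) \<and>
    (\<forall>\<tau>. sampling_rule T C N \<tau> \<longrightarrow>
       stress_encoder T C N \<tau> \<in> encoders T N \<and>
       worst_error T C N (stress_encoder T C N \<tau>) = minimax_error T C N \<and>
       (\<forall>\<pi>\<in>W11 T. recon_error T C N (stress_encoder T C N \<tau>) \<pi>
                     \<le> ereal (1 / (2 * real N) * norm_BV0 T \<pi>)))"
proof -
  have lower: "ereal (1 / (2 * real N)) \<le> minimax_error T C N"
    unfolding minimax_error_def using assms by (intro INF_greatest worst_error_ge)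
  note enc = stress_encoder_in_encoders[OF assms(1-4,6)]
  note err = recon_error_stress_encoder[OF assms(1-4,6)]
  have worst: "worst_error T C N (stress_encoder T C N \<tau>) \<le> ereal (1 / (2 * real N))"
    if \<tau>: "sampling_rule T C N \<tau>" for \<tau>
    unfolding worst_error_def
  proof (rule SUP_least)
    fix \<pi> :: "real \<Rightarrow> 'a" assume \<pi>: "\<pi> \<in> W11 T - {zero_fun T}"
    have BV: "0 < norm_BV0 T \<pi>" using norm_BV0_pos[OF assms(1) \<pi>] .
    have "recon_error T C N (stress_encoder T C N \<tau>) \<pi> / ereal (norm_BV0 T \<pi>)
        \<le> ereal (1 / (2 * real N) * norm_BV0 T \<pi>) / ereal (norm_BV0 T \<pi>)"
      using err[OF \<tau>, of \<pi>] \<pi> BV by (intro ereal_divide_right_mono) auto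
    then show "recon_error T C N (stress_encoder T C N \<tau>) \<pi> / ereal (norm_BV0 T \<pi>) \<le> ereal (1 / (2 * real N))"
      using BV by simp
  qed
  have upper: "minimax_error T C N \<le> worst_error T C N (stress_encoder T C N \<tau>)"
    if "sampling_rule T C N \<tau>" for \<tau>
    unfolding minimax_error_def using enc[OF that] by (rule INF_lower)
  obtain \<tau> where "sampling_rule T C N \<tau>" using ex_sampling_rule assms by blast
  then have "minimax_error T C N = ereal (1 / (2 * real N))"
    using lower upper worst by (meson order_antisym order_trans)
  moreover have "worst_error T C N (stress_encoder T C N \<tau>) = minimax_error T C N"
    if "sampling_rule T C N \<tau>" for \<tau>
    using lower upper[OF that] worst[OF that] by (meson order_antisym order_trans)
  ultimately show ?thesis using enc err \<open>sampling_rule T C N \<tau>\<close> by blast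
qed

end
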